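(* For every integer $n\ge3$, \begin{align*} h_2[h_1h_{n-1}] ={}& \sum_{\substack{1\le a\le n-1\\ a \text{ odd}}} s_{(1^2,a,2n-2-a)} + \sum_{\substack{2\le a\le n-1\\ a\text{ even}}} s_{(2,a,2n-2-a)} + s_{(1^2,2n-2)} + \sum_{2\le a\le n-1} 2\, s_{(1,a,2n-1-a)} \\ & + s_{(1,2n-1)} + \sum_{\substack{2\le a\le n-1\\ a\text{ even}}} 3\, s_{(a,2n-a)} + \sum_{\substack{2\le a\le n-1\\ a\text{ odd}}} s_{(a,2n-a)} + 2\,\chi(n\text{ even})\, s_{(n,n)} + s_{(2n)}. \end{align*}
   Context: $h_k$ denotes the $k$-th complete homogeneous symmetric function, $s_\lambda$ the Schur function indexed by the partition $\lambda$, and $f[g]$ the plethysm of symmetric functions. Partitions are written with parts in weakly increasing order, so e.g. $(1^2,a,b)$ denotes the partition with parts $1,1,a,b$ where $1\le a\le b$. For a statement $A$, $\chi(A)=1$ if $A$ is true and $0$ otherwise. *)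

theory Defs
  imports Complex_Main "HOL-Library.Multiset" "HOL-Library.FuncSet" "HOL-Library.Poly_Mapping"
begin

section \<open>Formal power series in countably many variables\<close>

text \<open>
  A monomial in the variables \<open>x\<^sub>0, x\<^sub>1, x\<^sub>2, \<dots>\<close> is encoded as the multiset of the indices of its
  variables, so \<open>count m i\<close> is the exponent of \<open>x\<^sub>i\<close> in \<open>m\<close>, multiplication of monomials is
  addition of multisets, and \<open>size m\<close> is the total degree. The ring of symmetric functions is a
  subring of the ring of power series defined here.
\<close>

typedef 'a mfps = "UNIV :: (nat multiset \<Rightarrow> 'a) set"
  morphisms mfps_coeff Abs_mfps
  by simp

lemma mfps_coeff_Abs [simp]: "mfps_coeff (Abs_mfps f) = f"
  by (simp add: Abs_mfps_inverse)

lemma mfps_eqI: "(\<And>m. mfps_coeff f m = mfps_coeff g m) \<Longrightarrow> f = g"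
  by (metis ext mfps_coeff_inject)

lemma finite_submultisets: "finite {a. a \<subseteq># (m :: 'b multiset)}"
proof (induction m)
  case empty
  show ?case by simp
next
  case (add x m)
  have "a \<in> {a. a \<subseteq># m} \<union> add_mset x ` {a. a \<subseteq># m}" if "a \<subseteq># add_mset x m" for a
  proof (cases "x \<in># a")
    case True
    then obtain b where "a = add_mset x b" by (metis insert_DiffM)
    with that show ?thesis by auto
  next
    case False
    then have "count a x = 0" by (simp add: count_eq_zero_iff)
    with that have "count a y \<le> count m y" for y
      by (cases "y = x") (auto dest: mset_subset_eq_count[where a = y])
    then show ?thesis by (simp add: subseteq_mset_def)
  qed
  then have "{a. a \<subseteq># add_mset x m} \<subseteq> {a. a \<subseteq># m} \<union> add_mset x ` {a. a \<subseteq># m}"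
    by blast
  with add show ?case by (meson finite_UnI finite_imageI finite_subset)
qed

lemma finite_factorizations: "finite {(a, b). a + b = (m :: 'b multiset)}"
proof (rule finite_subset)
  show "{(a, b). a + b = m} \<subseteq> {a. a \<subseteq># m} \<times> {a. a \<subseteq># m}" by auto
  show "finite ({a. a \<subseteq># m} \<times> {a. a \<subseteq># m})" by (simp add: finite_submultisets)
qed

instantiation mfps :: (comm_ring_1) comm_ring_1
begin

definition zero_mfps :: "'a mfps" where
  "0 = Abs_mfps (\<lambda>_. 0)"

definition one_mfps :: "'a mfps" where
  "1 = Abs_mfps (\<lambda>m. if m = {#} then 1 else 0)"

definition plus_mfps :: "'a mfps \<Rightarrow> 'a mfps \<Rightarrow> 'a mfps" where
  "f + g = Abs_mfps (\<lambda>m. mfps_coeff f m + mfps_coeff g m)"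

definition uminus_mfps :: "'a mfps \<Rightarrow> 'a mfps" where
  "- f = Abs_mfps (\<lambda>m. - mfps_coeff f m)"

definition minus_mfps :: "'a mfps \<Rightarrow> 'a mfps \<Rightarrow> 'a mfps" where
  "f - g = Abs_mfps (\<lambda>m. mfps_coeff f m - mfps_coeff g m)"

definition times_mfps :: "'a mfps \<Rightarrow> 'a mfps \<Rightarrow> 'a mfps" where
  "f * g = Abs_mfps (\<lambda>m. \<Sum>(a, b) | a + b = m. mfps_coeff f a * mfps_coeff g b)"

instance
proof
  fix f g h :: "'a mfps"
  show "f * g * h = f * (g * h)"
  proof (rule mfps_eqI)
    fix m :: "nat multiset"
    let ?f = "mfps_coeff f" and ?g = "mfps_coeff g" and ?h = "mfps_coeff h"
    have "mfps_coeff (f * g * h) m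
        = (\<Sum>(p, c) | p + c = m. \<Sum>(a, b) | a + b = p. ?f a * ?g b * ?h c)"
      by (simp add: times_mfps_def sum_distrib_right case_prod_unfold)
    also have "\<dots> = (\<Sum>(u, v) \<in> (SIGMA u:{(p, c). p + c = m}. {(a, b). a + b = fst u}).
                     ?f (fst v) * ?g (snd v) * ?h (snd u))"
      by (simp add: sum.Sigma finite_factorizations[unfolded case_prod_unfold] case_prod_unfold)
    also have "\<dots> = (\<Sum>(u, v) \<in> (SIGMA u:{(a, q). a + q = m}. {(b, c). b + c = snd u}).
                     ?f (fst u) * (?g (fst v) * ?h (snd v)))"
      by (rule sum.reindex_bij_witness
            [where i = "\<lambda>((a, q), (b, c)). ((a + b, c), (a, b))"
               and j = "\<lambda>((p, c), (a, b)). ((a, b + c), (b, c))"])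
         (auto simp: add.assoc mult.assoc)
    also have "\<dots> = (\<Sum>(a, q) | a + q = m. \<Sum>(b, c) | b + c = q. ?f a * (?g b * ?h c))"
      by (simp add: sum.Sigma finite_factorizations[unfolded case_prod_unfold] case_prod_unfold)
    also have "\<dots> = mfps_coeff (f * (g * h)) m"
      by (simp add: times_mfps_def sum_distrib_left case_prod_unfold)
    finally show "mfps_coeff (f * g * h) m = mfps_coeff (f * (g * h)) m" .
  qed
  show "f * g = g * f"
    unfolding times_mfps_def
    by (rule arg_cong[where f = Abs_mfps], rule ext,
        rule sum.reindex_bij_witness[where i = prod.swap and j = prod.swap])
       (auto simp: add.commute mult.commute)
  show "1 * f = f"
  proof (rule mfps_eqI)
    fix m :: "nat multiset"
    have "mfps_coeff (1 * f) m
        = (\<Sum>u | fst u + snd u = m. if u = ({#}, m) then mfps_coeff f m else 0)"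
      by (auto simp: times_mfps_def one_mfps_def case_prod_unfold intro!: sum.cong)
    also have "\<dots> = mfps_coeff f m"
      using finite_factorizations[of m] by (simp add: case_prod_unfold)
    finally show "mfps_coeff (1 * f) m = mfps_coeff f m" .
  qed
  show "(f + g) * h = f * h + g * h"
    by (rule mfps_eqI)
       (simp add: times_mfps_def plus_mfps_def case_prod_unfold distrib_right sum.distrib)
  show "f + g + h = f + (g + h)" "f + g = g + f" "0 + f = f" "- f + f = 0" "f - g = f + - g"
    by (auto intro!: mfps_eqI
        simp: plus_mfps_def zero_mfps_def uminus_mfps_def minus_mfps_def add_ac)
  have "mfps_coeff (0 :: 'a mfps) {#} \<noteq> mfps_coeff (1 :: 'a mfps) {#}"
    by (simp add: zero_mfps_def one_mfps_def)
  then show "(0 :: 'a mfps) \<noteq> 1" by auto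
qed

end

definition mfps_scale :: "'a::comm_ring_1 \<Rightarrow> 'a mfps \<Rightarrow> 'a mfps" where
  "mfps_scale c f = Abs_mfps (\<lambda>m. c * mfps_coeff f m)"


section \<open>Complete homogeneous symmetric functions and Schur functions\<close>

definition complete_homogeneous :: "nat \<Rightarrow> rat mfps" where
  "complete_homogeneous k = Abs_mfps (\<lambda>m. of_bool (size m = k))"

text \<open>
  A partition is the list of its (positive) parts in weakly increasing order. Row \<open>0\<close> of the Young
  diagram is the longest one, which is why the list is reversed.
\<close>

definition young_diagram :: "nat list \<Rightarrow> (nat \<times> nat) set" where
  "young_diagram \<mu> = {(i, j). i < length \<mu> \<and> j < rev \<mu> ! i}"

text \<open>Entries start from \<open>0\<close>, like the indices of the variables.\<close>

definition ssyt :: "nat list \<Rightarrow> (nat \<times> nat \<Rightarrow> nat) set" where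
  "ssyt \<mu> = {T \<in> extensional (young_diagram \<mu>).
     (\<forall>i j j'. (i, j) \<in> young_diagram \<mu> \<longrightarrow> (i, j') \<in> young_diagram \<mu> \<longrightarrow> j < j' \<longrightarrow>
        T (i, j) \<le> T (i, j')) \<and>
     (\<forall>i i' j. (i, j) \<in> young_diagram \<mu> \<longrightarrow> (i', j) \<in> young_diagram \<mu> \<longrightarrow> i < i' \<longrightarrow>
        T (i, j) < T (i', j))}"

definition tableau_weight :: "nat list \<Rightarrow> (nat \<times> nat \<Rightarrow> nat) \<Rightarrow> nat multiset" where
  "tableau_weight \<mu> T = image_mset T (mset_set (young_diagram \<mu>))"

lemma finite_young_diagram: "finite (young_diagram \<mu>)"
proof (rule finite_subset)
  show "young_diagram \<mu> \<subseteq> (SIGMA i:{..<length \<mu>}. {..<rev \<mu> ! i})"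
    by (auto simp: young_diagram_def)
qed auto

lemma finite_ssyt_weight: "finite {T \<in> ssyt \<mu>. tableau_weight \<mu> T = m}"
proof (rule finite_subset)
  show "{T \<in> ssyt \<mu>. tableau_weight \<mu> T = m} \<subseteq> (\<Pi>\<^sub>E c\<in>young_diagram \<mu>. set_mset m)"
    by (auto simp: ssyt_def tableau_weight_def PiE_def finite_young_diagram)
  show "finite (\<Pi>\<^sub>E c\<in>young_diagram \<mu>. set_mset m)"
    by (simp add: finite_PiE finite_young_diagram)
qed

definition schur :: "nat list \<Rightarrow> rat mfps" where
  "schur \<mu> = Abs_mfps (\<lambda>m. of_nat (card {T \<in> ssyt \<mu>. tableau_weight \<mu> T = m}))"


section \<open>Plethysm\<close>

definition power_sum :: "nat \<Rightarrow> rat mfps" where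
  "power_sum k = Abs_mfps (\<lambda>m. of_bool (\<exists>i. m = replicate_mset k i))"

text \<open>
  For \<open>k \<ge> 1\<close>, the image of \<open>g\<close> under the substitution \<open>x\<^sub>i \<mapsto> x\<^sub>i\<^sup>k\<close>. Here \<open>repeat_mset k m'\<close> is the
  \<open>k\<close>-th power of the monomial \<open>m'\<close>, so the sum has at most one summand.
\<close>

definition adams :: "nat \<Rightarrow> rat mfps \<Rightarrow> rat mfps" where
  "adams k g = Abs_mfps (\<lambda>m. \<Sum>m' | repeat_mset k m' = m. mfps_coeff g m')"

text \<open>
  The products \<open>p\<^sub>\<mu> = \<Prod>\<^sub>k\<^sub>\<in>\<^sub>\<mu> p\<^sub>k\<close>, for \<open>\<mu>\<close> a finite multiset of positive integers, form a basis of the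
  vector space of symmetric functions with rational coefficients, so every symmetric function has a
  unique (finite) expansion in them.
\<close>

definition power_sum_expansion :: "rat mfps \<Rightarrow> (nat multiset \<Rightarrow>\<^sub>0 rat)" where
  "power_sum_expansion f = (THE c. (\<forall>\<mu>\<in>Poly_Mapping.keys c. 0 \<notin># \<mu>) \<and>
     f = (\<Sum>\<mu>\<in>Poly_Mapping.keys c.
            mfps_scale (Poly_Mapping.lookup c \<mu>) (\<Prod>k\<in>#\<mu>. power_sum k)))"

text \<open>
  The plethysm \<open>f[g]\<close>, for a symmetric function \<open>f\<close>: the map \<open>f \<mapsto> f[g]\<close> is the homomorphism of
  algebras over the rationals that sends \<open>p\<^sub>k\<close> to \<open>p\<^sub>k[g] = g(x\<^sub>0\<^sup>k, x\<^sub>1\<^sup>k, \<dots>)\<close> for all \<open>k \<ge> 1\<close>.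
\<close>

definition plethysm :: "rat mfps \<Rightarrow> rat mfps \<Rightarrow> rat mfps" where
  "plethysm f g =
     (\<Sum>\<mu>\<in>Poly_Mapping.keys (power_sum_expansion f).
        mfps_scale (Poly_Mapping.lookup (power_sum_expansion f) \<mu>) (\<Prod>k\<in>#\<mu>. adams k g))"

end

theory Submission
  imports Defs "Jordan_Normal_Form.Determinant"
begin

text \<open>
  Since \<open>2 h\<^sub>2 = p\<^sub>1\<^sup>2 + p\<^sub>2\<close>, we have \<open>2 h\<^sub>2[f] = f\<^sup>2 + p\<^sub>2[f]\<close>. For \<open>f = h\<^sub>1 h\<^sub>m\<close> with \<open>m = n - 1\<close>, both
  \<open>h\<^sub>m\<^sup>2\<close> and \<open>p\<^sub>2[h\<^sub>m] = \<Sum>\<^sub>i (-1)\<^sup>i h\<^sub>i h\<^bsub>2m-i\<^esub>\<close> telescope, into the sums over \<open>0 \<le> k \<le> m\<close> of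
  \<open>s\<^bsub>(k,2m-k)\<^esub>\<close> and of \<open>(-1)\<^sup>k s\<^bsub>(k,2m-k)\<^esub>\<close> respectively. With \<open>p\<^sub>1\<^sup>2 = h\<^sub>2 + e\<^sub>2\<close> and \<open>p\<^sub>2 = h\<^sub>2 - e\<^sub>2\<close>
  it follows that \<open>h\<^sub>2[h\<^sub>1 h\<^sub>m]\<close> is the sum of the \<open>h\<^sub>2 s\<^bsub>(k,2m-k)\<^esub>\<close> for even \<open>k\<close> and the
  \<open>e\<^sub>2 s\<^bsub>(k,2m-k)\<^esub>\<close> for odd \<open>k\<close>. Both kinds of products are expanded by the Pieri rules, which for
  these shapes are polynomial identities between Jacobi--Trudi determinants.
\<close>


section \<open>Coefficients and monomials\<close>

lemma mfps_coeff_zero [simp]: "mfps_coeff 0 m = 0"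
  by (simp add: zero_mfps_def)

lemma mfps_coeff_one: "mfps_coeff 1 m = of_bool (m = {#})"
  by (simp add: one_mfps_def)

lemma mfps_coeff_add [simp]: "mfps_coeff (f + g) m = mfps_coeff f m + mfps_coeff g m"
  by (simp add: plus_mfps_def)

lemma mfps_coeff_uminus [simp]: "mfps_coeff (- f) m = - mfps_coeff f m"
  by (simp add: uminus_mfps_def)

lemma mfps_coeff_minus [simp]: "mfps_coeff (f - g) m = mfps_coeff f m - mfps_coeff g m"
  by (simp add: minus_mfps_def)

lemma mfps_coeff_scale [simp]: "mfps_coeff (mfps_scale c f) m = c * mfps_coeff f m"
  by (simp add: mfps_scale_def)

lemma mfps_coeff_sum [simp]: "mfps_coeff (sum f A) m = (\<Sum>x\<in>A. mfps_coeff (f x) m)"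
  by (induction A rule: infinite_finite_induct) auto

lemma mfps_coeff_mult: "mfps_coeff (f * g) m = (\<Sum>a | a \<subseteq># m. mfps_coeff f a * mfps_coeff g (m - a))"
proof -
  have "mfps_coeff (f * g) m = (\<Sum>(a, b) | a + b = m. mfps_coeff f a * mfps_coeff g b)"
    by (simp add: times_mfps_def)
  also have "\<dots> = (\<Sum>a | a \<subseteq># m. mfps_coeff f a * mfps_coeff g (m - a))"
    by (rule sum.reindex_bij_witness[where i = "\<lambda>a. (a, m - a)" and j = fst]) auto
  finally show ?thesis .
qed

definition mfps_monom :: "nat multiset \<Rightarrow> 'a::comm_ring_1 mfps" where
  "mfps_monom m = Abs_mfps (\<lambda>m'. of_bool (m' = m))"

lemma mfps_coeff_monom: "mfps_coeff (mfps_monom a) m = of_bool (m = a)"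
  by (simp add: mfps_monom_def)

lemma mfps_coeff_monom_mult:
  "mfps_coeff (mfps_monom a * f) m = (if a \<subseteq># m then mfps_coeff f (m - a) else 0)"
proof -
  have "mfps_coeff (mfps_monom a * f) m
      = (\<Sum>b | b \<subseteq># m. if b = a then mfps_coeff f (m - b) else 0)"
    by (auto simp: mfps_coeff_mult mfps_coeff_monom intro!: sum.cong)
  then show ?thesis by (simp add: finite_submultisets)
qed

lemma mfps_monom_add: "mfps_monom (a + b) = mfps_monom a * mfps_monom b"
proof (rule mfps_eqI)
  fix m
  have "m = a + b \<longleftrightarrow> a \<subseteq># m \<and> m - a = b"
    by (metis add_diff_cancel_left' mset_subset_eq_add_left subset_mset.add_diff_inverse)
  then show "mfps_coeff (mfps_monom (a + b)) m = mfps_coeff (mfps_monom a * mfps_monom b) m"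
    by (simp add: mfps_coeff_monom_mult mfps_coeff_monom)
qed

lemma mfps_monom_empty: "mfps_monom {#} = 1"
  by (rule mfps_eqI) (simp add: mfps_coeff_monom mfps_coeff_one)

lemma mfps_monom_replicate:
  "(mfps_monom (replicate_mset k i) :: 'a::comm_ring_1 mfps) = mfps_monom {#i#} ^ k"
proof (induction k)
  case (Suc k)
  have "(mfps_monom (replicate_mset (Suc k) i) :: 'a mfps) = mfps_monom ({#i#} + replicate_mset k i)"
    by simp
  also have "\<dots> = mfps_monom {#i#} * mfps_monom {#i#} ^ k"
    by (simp only: mfps_monom_add Suc)
  finally show ?case by simp
qed (simp add: mfps_monom_empty)


section \<open>Power sums and plethysm with \<open>h\<^sub>2\<close>\<close>

abbreviation power_sum_prod :: "nat multiset \<Rightarrow> rat mfps" where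
  "power_sum_prod \<mu> \<equiv> \<Prod>k\<in>#\<mu>. power_sum k"

text \<open>The partition recording a monomial up to renaming its variables.\<close>

definition exponents :: "nat multiset \<Rightarrow> nat multiset" where
  "exponents m = image_mset (count m) (mset_set (set_mset m))"

text \<open>Multiplying by p_k means peeling off the k-th power of one variable; the inductions on
  \<mu> below run on this recursion. For \<open>k = 0\<close> every index would give the empty
  monomial, so distinct indices would no longer give distinct factors.\<close>

lemma power_sum_mult_coeff:
  assumes "k > 0"
  shows "mfps_coeff (power_sum k * f) m
      = (\<Sum>i | replicate_mset k i \<subseteq># m. mfps_coeff f (m - replicate_mset k i))"
proof -
  have "mfps_coeff (power_sum k * f) m
      = (\<Sum>a\<in>{a. a \<subseteq># m}. of_bool (\<exists>i. a = replicate_mset k i) * mfps_coeff f (m - a))"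
    by (simp add: mfps_coeff_mult power_sum_def)
  also have "\<dots> = (\<Sum>a\<in>{a. a \<subseteq># m \<and> (\<exists>i. a = replicate_mset k i)}. mfps_coeff f (m - a))"
    by (rule sum.mono_neutral_cong_right) (auto simp: finite_submultisets)
  also have "{a. a \<subseteq># m \<and> (\<exists>i. a = replicate_mset k i)}
      = replicate_mset k ` {i. replicate_mset k i \<subseteq># m}"
    by auto
  also have "(\<Sum>a\<in>\<dots>. mfps_coeff f (m - a))
      = (\<Sum>i | replicate_mset k i \<subseteq># m. mfps_coeff f (m - replicate_mset k i))"
    using assms by (subst sum.reindex) (auto simp: inj_on_def replicate_mset_eq_iff)
  finally show ?thesis .
qed

lemma finite_replicate_mset_subset: "k > 0 \<Longrightarrow> finite {i. replicate_mset k i \<subseteq># m}"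
  by (rule finite_subset[of _ "set_mset m"])
     (auto dest!: set_mset_mono)

lemma power_sum_prod_coeff_nonneg: "0 \<notin># \<mu> \<Longrightarrow> mfps_coeff (power_sum_prod \<mu>) m \<ge> 0"
proof (induction \<mu> arbitrary: m)
  case (add k \<mu>)
  then show ?case by (auto simp: power_sum_mult_coeff intro!: sum_nonneg)
qed (simp add: mfps_coeff_one)

lemma exponents_add_fresh:
  assumes "i \<notin># m" "k > 0"
  shows "exponents (replicate_mset k i + m) = add_mset k (exponents m)"
proof -
  have "set_mset (replicate_mset k i + m) = insert i (set_mset m)" using assms by auto
  then have "exponents (replicate_mset k i + m)
      = add_mset k (image_mset (count (replicate_mset k i + m)) (mset_set (set_mset m)))"
    using assms by (simp add: exponents_def not_in_iff)
  also have "image_mset (count (replicate_mset k i + m)) (mset_set (set_mset m)) = exponents m"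
    unfolding exponents_def using assms(1) by (intro image_mset_cong) auto
  finally show ?thesis .
qed

text \<open>A monomial of p_\<mu> arises by choosing a variable for each part of \<mu>. It therefore
  involves at most one variable per part, and in case of equality the chosen variables are distinct,
  so that the exponents are exactly the parts.\<close>

lemma power_sum_prod_coeff_nonzero:
  assumes "0 \<notin># \<mu>" "mfps_coeff (power_sum_prod \<mu>) m \<noteq> 0"
  shows "card (set_mset m) \<le> size \<mu>" "card (set_mset m) = size \<mu> \<Longrightarrow> exponents m = \<mu>"
proof -
  have "card (set_mset m) \<le> size \<mu> \<and> (card (set_mset m) = size \<mu> \<longrightarrow> exponents m = \<mu>)"
    using assms
  proof (induction \<mu> arbitrary: m)
    case empty
    then show ?case by (auto simp: mfps_coeff_one exponents_def split: if_splits)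
  next
    case (add k \<mu>)
    then have "k > 0" by auto
    with add.prems obtain i where i: "replicate_mset k i \<subseteq># m"
      "mfps_coeff (power_sum_prod \<mu>) (m - replicate_mset k i) \<noteq> 0"
      by (auto simp: power_sum_mult_coeff elim: sum.not_neutral_contains_not_neutral)
    define m' where "m' = m - replicate_mset k i"
    have m: "m = replicate_mset k i + m'"
      using i(1) by (simp add: m'_def)
    have IH: "card (set_mset m') \<le> size \<mu>" "card (set_mset m') = size \<mu> \<Longrightarrow> exponents m' = \<mu>"
      using add.IH[of m'] add.prems(1) i(2) by (auto simp: m'_def)
    have set: "set_mset m = insert i (set_mset m')" using \<open>k > 0\<close> by (auto simp: m)
    show ?case
    proof (cases "i \<in># m'")
      case True
      then show ?thesis using IH(1) by (simp add: set insert_absorb)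
    next
      case False
      then show ?thesis using IH exponents_add_fresh[OF False \<open>k > 0\<close>] by (simp add: set m[symmetric])
    qed
  qed
  then show "card (set_mset m) \<le> size \<mu>" "card (set_mset m) = size \<mu> \<Longrightarrow> exponents m = \<mu>" by auto
qed

text \<open>Choose a fresh variable for each part. Since all coefficients are nonnegative, nothing
  can cancel the resulting monomial.\<close>

lemma power_sum_prod_coeff_leading:
  assumes "0 \<notin># \<mu>"
  obtains m where "card (set_mset m) = size \<mu>" "mfps_coeff (power_sum_prod \<mu>) m > 0"
  using assms
proof (induction \<mu> arbitrary: thesis)
  case empty
  show ?case by (rule empty(1)[of "{#}"]) (simp_all add: mfps_coeff_one)
next
  case (add k \<mu>)
  then have "k > 0" by auto
  from add obtain m' where m': "card (set_mset m') = size \<mu>" "mfps_coeff (power_sum_prod \<mu>) m' > 0"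
    by auto
  obtain i where i: "i \<notin># m'" using ex_new_if_finite[OF infinite_UNIV_nat finite_set_mset] by blast
  let ?m = "replicate_mset k i + m'"
  have "set_mset ?m = insert i (set_mset m')" using \<open>k > 0\<close> by auto
  then have "card (set_mset ?m) = size (add_mset k \<mu>)" using i m' by simp
  moreover have "mfps_coeff (power_sum_prod (add_mset k \<mu>)) ?m > 0"
  proof -
    have "0 < mfps_coeff (power_sum_prod \<mu>) (?m - replicate_mset k i)" using m' by simp
    also have "\<dots> \<le> (\<Sum>j | replicate_mset k j \<subseteq># ?m.
          mfps_coeff (power_sum_prod \<mu>) (?m - replicate_mset k j))"
      using add.prems(2) \<open>k > 0\<close>
      by (intro member_le_sum) (auto intro: power_sum_prod_coeff_nonneg finite_replicate_mset_subset)
    finally show ?thesis using \<open>k > 0\<close> by (simp add: power_sum_mult_coeff)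
  qed
  ultimately show ?case by (rule add.prems(1))
qed

section \<open>Linear independence of the products of power sums\<close>

definition power_sum_comb :: "(nat multiset \<Rightarrow>\<^sub>0 rat) \<Rightarrow> rat mfps" where
  "power_sum_comb c = (\<Sum>\<mu>\<in>Poly_Mapping.keys c. mfps_scale (Poly_Mapping.lookup c \<mu>) (power_sum_prod \<mu>))"

lemma power_sum_comb_superset:
  assumes "finite A" "Poly_Mapping.keys c \<subseteq> A"
  shows "power_sum_comb c = (\<Sum>\<mu>\<in>A. mfps_scale (Poly_Mapping.lookup c \<mu>) (power_sum_prod \<mu>))"
  unfolding power_sum_comb_def using assms
  by (intro sum.mono_neutral_left) (auto simp: in_keys_iff intro!: mfps_eqI)

text \<open>
  The monomial in distinct variables with exponents \<open>\<lambda>\<close> occurs in \<open>p\<^sub>\<mu>\<close> only if \<open>\<mu>\<close> refines \<open>\<lambda>\<close>.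
  So it detects \<open>p\<^sub>\<lambda>\<close> if \<open>\<lambda>\<close> has the maximal number of parts among the terms of a combination.
\<close>

lemma power_sum_comb_eq_0:
  assumes "\<forall>\<mu>\<in>Poly_Mapping.keys c. 0 \<notin># \<mu>" "power_sum_comb c = 0"
  shows "c = 0"
proof (rule ccontr)
  let ?K = "Poly_Mapping.keys c" and ?c = "Poly_Mapping.lookup c"
  assume "c \<noteq> 0"
  then have "?K \<noteq> {}" by simp
  have "Max (size ` ?K) \<in> size ` ?K" using \<open>?K \<noteq> {}\<close> by (intro Max_in) auto
  then obtain \<nu> where \<nu>: "\<nu> \<in> ?K" "\<And>\<mu>. \<mu> \<in> ?K \<Longrightarrow> size \<mu> \<le> size \<nu>"
    by (metis (no_types, lifting) Max_ge finite_imageI finite_keys image_eqI imageE)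
  obtain m where m: "card (set_mset m) = size \<nu>" "mfps_coeff (power_sum_prod \<nu>) m > 0"
    using power_sum_prod_coeff_leading assms(1) \<nu>(1) by metis
  \<comment> \<open>No other key has more parts than \<nu>. If \<mu> contributed to
    \<open>m\<close>, it would have exactly as many parts as \<nu>, hence
    \<open>\<mu> = exponents m = \<nu>\<close>.\<close>
  have "exponents m = \<nu>" using power_sum_prod_coeff_nonzero(2) assms(1) \<nu>(1) m by simp
  then have "mfps_coeff (power_sum_prod \<mu>) m = 0" if "\<mu> \<in> ?K" "\<mu> \<noteq> \<nu>" for \<mu>
    using power_sum_prod_coeff_nonzero[of \<mu> m] assms(1) \<nu>(2)[of \<mu>] that m by fastforce
  then have "(\<Sum>\<mu>\<in>?K. ?c \<mu> * mfps_coeff (power_sum_prod \<mu>) m)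
      = (\<Sum>\<mu>\<in>?K. if \<mu> = \<nu> then ?c \<nu> * mfps_coeff (power_sum_prod \<nu>) m else 0)"
    by (intro sum.cong) auto
  then have "mfps_coeff (power_sum_comb c) m = \<dots>"
    by (simp add: power_sum_comb_def)
  also have "\<dots> = ?c \<nu> * mfps_coeff (power_sum_prod \<nu>) m" using \<nu>(1) by simp
  finally show False using assms(2) m(2) \<nu>(1) by (simp add: in_keys_iff)
qed

text \<open>Linear independence gives the uniqueness demanded by the definite description, so any
  explicit expansion evaluates \<open>power_sum_expansion\<close>.\<close>

lemma power_sum_expansion_eqI:
  assumes "\<forall>\<mu>\<in>Poly_Mapping.keys c. 0 \<notin># \<mu>" "f = power_sum_comb c"
  shows "power_sum_expansion f = c"
  unfolding power_sum_expansion_def power_sum_comb_def[symmetric]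
proof (rule the_equality)
  fix d assume d: "(\<forall>\<mu>\<in>Poly_Mapping.keys d. 0 \<notin># \<mu>) \<and> f = power_sum_comb d"
  let ?A = "Poly_Mapping.keys c \<union> Poly_Mapping.keys d"
  have keys: "Poly_Mapping.keys (d - c) \<subseteq> ?A"
    by (auto simp: in_keys_iff lookup_minus)
  have "power_sum_comb (d - c) = power_sum_comb d - power_sum_comb c"
    using keys
    by (subst (1 2 3) power_sum_comb_superset[of ?A])
       (auto intro!: mfps_eqI simp: lookup_minus sum_subtractf left_diff_distrib)
  then have "d - c = 0"
    using d assms keys by (intro power_sum_comb_eq_0) auto
  then show "d = c" by simp
qed (use assms in auto)

section \<open>The substitution of k-th powers for the variables\<close>

lemma repeat_mset_inj: "k > 0 \<Longrightarrow> repeat_mset k a = repeat_mset k b \<longleftrightarrow> a = b"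
  by (auto simp: multiset_eq_iff)

lemma adams_coeff_repeat: "k > 0 \<Longrightarrow> mfps_coeff (adams k g) (repeat_mset k m) = mfps_coeff g m"
  by (simp add: adams_def repeat_mset_inj)

lemma adams_coeff_not_repeat: "m \<notin> range (repeat_mset k) \<Longrightarrow> mfps_coeff (adams k g) m = 0"
  by (auto simp: adams_def intro!: sum.neutral)

lemma adams_1: "adams (Suc 0) g = g"
  by (rule mfps_eqI) (use adams_coeff_repeat[of "Suc 0" g] in simp)

lemma repeat_mset_subset_iff: "k > 0 \<Longrightarrow> repeat_mset k a \<subseteq># repeat_mset k b \<longleftrightarrow> a \<subseteq># b"
  by (simp add: subseteq_mset_def)

lemma repeat_mset_diff: "repeat_mset k (a - b) = repeat_mset k a - repeat_mset k b"
  by (rule multiset_eqI) (simp add: diff_mult_distrib2)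

text \<open>Factorizations of a k-th power into two k-th powers correspond to factorizations of its
  root, and every other factorization contributes zero. A monomial that is not a k-th power is not a
  product of two k-th powers either.\<close>

lemma adams_mult:
  assumes "k > 0"
  shows "adams k (f * g) = adams k f * adams k g"
proof (rule mfps_eqI)
  fix m :: "nat multiset"
  show "mfps_coeff (adams k (f * g)) m = mfps_coeff (adams k f * adams k g) m"
  proof (cases "m \<in> range (repeat_mset k)")
    case True
    then obtain m' where m: "m = repeat_mset k m'" by auto
    have "mfps_coeff (adams k f * adams k g) m
        = (\<Sum>a | a \<subseteq># m. mfps_coeff (adams k f) a * mfps_coeff (adams k g) (m - a))"
      by (simp add: mfps_coeff_mult)
    also have "\<dots> = (\<Sum>a\<in>repeat_mset k ` {a. a \<subseteq># m'}.
         mfps_coeff (adams k f) a * mfps_coeff (adams k g) (m - a))"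
    proof (rule sum.mono_neutral_right)
      show "\<forall>a\<in>{a. a \<subseteq># m} - repeat_mset k ` {a. a \<subseteq># m'}.
          mfps_coeff (adams k f) a * mfps_coeff (adams k g) (m - a) = 0"
        using assms by (auto simp: m repeat_mset_subset_iff intro!: adams_coeff_not_repeat)
    qed (use assms in \<open>auto simp: m finite_submultisets repeat_mset_subset_iff\<close>)
    also have "\<dots> = (\<Sum>a | a \<subseteq># m'. mfps_coeff f a * mfps_coeff g (m' - a))"
      using assms
      by (subst sum.reindex)
         (auto simp: inj_on_def repeat_mset_inj adams_coeff_repeat m simp flip: repeat_mset_diff)
    finally show ?thesis using assms by (simp add: m adams_coeff_repeat mfps_coeff_mult)
  next
    case False
    have "a \<notin> range (repeat_mset k) \<or> m - a \<notin> range (repeat_mset k)" if a: "a \<subseteq># m" for a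
    proof (rule ccontr)
      assume "\<not> ?thesis"
      then obtain b c where "a = repeat_mset k b" "m - a = repeat_mset k c" by auto
      then have "m = repeat_mset k (b + c)"
        using a by (metis repeat_mset_distrib2 subset_mset.add_diff_inverse)
      with False show False by blast
    qed
    then have "mfps_coeff (adams k f * adams k g) m = 0"
      unfolding mfps_coeff_mult by (intro sum.neutral) (auto dest: adams_coeff_not_repeat)
    with False show ?thesis by (simp add: adams_coeff_not_repeat)
  qed
qed

section \<open>The expansion of p_2[h_k] in complete homogeneous functions\<close>

lemma sum_alternating_sign: "(\<Sum>d\<le>c. (- 1 :: 'a::comm_ring_1) ^ d) = of_bool (even c)"
  by (induction c) auto

text \<open>The sum is a product over the variables of alternating sums, each 1 or 0 according to
  whether the exponent is even or odd. The induction splits off one variable at a time.\<close>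

lemma sum_signed_submultisets:
  "(\<Sum>a | a \<subseteq># m. (- 1 :: 'a::comm_ring_1) ^ size a) = of_bool (\<forall>i. even (count m i))"
proof (induction "card (set_mset m)" arbitrary: m)
  case 0
  then show ?case by simp
next
  case (Suc n)
  then obtain i where i: "i \<in># m" by (metis card.empty equals0I nat.distinct(1))
  define c where "c = count m i"
  define m' where "m' = filter_mset (\<lambda>j. j \<noteq> i) m"
  have m: "m = replicate_mset c i + m'"
    by (auto simp: multiset_eq_iff c_def m'_def)
  have "set_mset m' = set_mset m - {i}" by (auto simp: m'_def)
  then have "n = card (set_mset m')" using Suc(2) i by simp
  then have IH: "(\<Sum>a | a \<subseteq># m'. (- 1 :: 'a) ^ size a) = of_bool (\<forall>j. even (count m' j))"
    by (rule Suc(1))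
  have "i \<notin># m'" by (simp add: m'_def)
  then have i0: "count m' i = 0" "\<And>b. b \<subseteq># m' \<Longrightarrow> count b i = 0"
    by (auto simp: count_eq_zero_iff dest: mset_subset_eqD)
  have "(\<Sum>a | a \<subseteq># m. (- 1 :: 'a) ^ size a)
      = (\<Sum>(d, b)\<in>{..c} \<times> {b. b \<subseteq># m'}. (- 1) ^ d * (- 1) ^ size b)"
  proof (rule sum.reindex_bij_witness[where
        i = "\<lambda>(d, b). replicate_mset d i + b" and j = "\<lambda>a. (count a i, filter_mset (\<lambda>j. j \<noteq> i) a)"])
    fix a assume "a \<in> {a. a \<subseteq># m}"
    then have a: "count a j \<le> count m j" for j by (simp add: mset_subset_eq_count)
    have split: "a = replicate_mset (count a i) i + filter_mset (\<lambda>j. j \<noteq> i) a"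
      by (auto simp: multiset_eq_iff)
    then show "(case (count a i, filter_mset (\<lambda>j. j \<noteq> i) a) of (d, b) \<Rightarrow> replicate_mset d i + b) = a"
      by simp
    show "(count a i, filter_mset (\<lambda>j. j \<noteq> i) a) \<in> {..c} \<times> {b. b \<subseteq># m'}"
      using a by (auto simp: c_def m'_def subseteq_mset_def)
    show "(case (count a i, filter_mset (\<lambda>j. j \<noteq> i) a) of (d, b) \<Rightarrow> (- 1 :: 'a) ^ d * (- 1) ^ size b)
        = (- 1) ^ size a"
      by (subst (3) split) (simp add: power_add)
  next
    fix p assume "p \<in> {..c} \<times> {b. b \<subseteq># m'}"
    then obtain d b where p: "p = (d, b)" "d \<le> c" "b \<subseteq># m'" by auto
    then show "(count (case p of (d, b) \<Rightarrow> replicate_mset d i + b) i,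
        filter_mset (\<lambda>j. j \<noteq> i) (case p of (d, b) \<Rightarrow> replicate_mset d i + b)) = p"
      using i0(2)[of b] by (auto simp: multiset_eq_iff)
    show "(case p of (d, b) \<Rightarrow> replicate_mset d i + b) \<in> {a. a \<subseteq># m}"
      using p by (auto simp: m subseteq_mset_def intro!: add_mono)
  qed
  also have "\<dots> = (\<Sum>d\<le>c. (- 1) ^ d) * (\<Sum>b | b \<subseteq># m'. (- 1) ^ size b)"
    by (simp add: sum_product sum.cartesian_product)
  also have "\<dots> = of_bool (even c \<and> (\<forall>j. even (count m' j)))"
    by (simp add: sum_alternating_sign IH)
  also have "even c \<and> (\<forall>j. even (count m' j)) \<longleftrightarrow> (\<forall>j. even (count m j))"
  proof -
    have "count m j = (if j = i then c else count m' j)" for j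
      by (simp add: c_def m'_def)
    then show ?thesis using i0(1) by (metis even_zero)
  qed
  finally show ?case .
qed

lemma range_repeat_mset_2: "m \<in> range (repeat_mset 2) \<longleftrightarrow> (\<forall>i. even (count m i))"
proof
  assume even: "\<forall>i. even (count m i)"
  define m' where "m' = Abs_multiset (\<lambda>i. count m i div 2)"
  have "finite {i. 0 < count m i div 2}"
    by (rule finite_subset[of _ "set_mset m"]) (auto intro!: count_inI)
  then have "count m' = (\<lambda>i. count m i div 2)" by (simp add: m'_def Abs_multiset_inverse)
  then have "m = repeat_mset 2 m'" using even by (simp add: multiset_eq_iff)
  then show "m \<in> range (repeat_mset 2)" by blast
qed auto

text \<open>This is the coefficientwise form of \<open>H(t) H(-t) = \<Prod>\<^sub>i 1 / (1 - x\<^sub>i\<^sup>2 t\<^sup>2)\<close>.\<close>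

lemma adams_2_complete_homogeneous:
  "adams 2 (complete_homogeneous k)
     = (\<Sum>i\<le>2 * k. (- 1) ^ i * complete_homogeneous i * complete_homogeneous (2 * k - i))"
proof (rule mfps_eqI)
  fix m :: "nat multiset"
  let ?h = complete_homogeneous
  \<comment> \<open>On the left the sign is a power series, on the right a rational number.\<close>
  have "mfps_coeff ((- 1) ^ i * f) m = (- 1) ^ i * mfps_coeff f m" for i and f :: "rat mfps"
    by (induction i) auto
  then have "mfps_coeff ((- 1) ^ i * ?h i * ?h j) m = (- 1) ^ i * mfps_coeff (?h i * ?h j) m" for i j
    by (simp only: mult.assoc)
  then have "mfps_coeff ((- 1) ^ i * ?h i * ?h j) m
      = (\<Sum>a | a \<subseteq># m. (- 1) ^ i * of_bool (size a = i \<and> size (m - a) = j))" for i j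
    by (simp add: mfps_coeff_mult complete_homogeneous_def sum_distrib_left of_bool_conj)
  then have "mfps_coeff (\<Sum>i\<le>2 * k. (- 1) ^ i * ?h i * ?h (2 * k - i)) m
      = (\<Sum>i\<le>2 * k. \<Sum>a | a \<subseteq># m. (- 1) ^ i * of_bool (size a = i \<and> size (m - a) = 2 * k - i))"
    by simp
  also have "\<dots> = (\<Sum>a | a \<subseteq># m. \<Sum>i\<le>2 * k. (- 1) ^ i * of_bool (size a = i \<and> size (m - a) = 2 * k - i))"
    by (rule sum.swap)
  also have "\<dots> = (\<Sum>a | a \<subseteq># m. of_bool (size m = 2 * k) * (- 1) ^ size a)"
  proof (rule sum.cong[OF refl])
    fix a assume "a \<in> {a. a \<subseteq># m}"
    then have size: "size (m - a) = size m - size a" "size a \<le> size m"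
      by (simp_all add: size_Diff_submset size_mset_mono)
    have "(\<Sum>i\<le>2 * k. (- 1) ^ i * of_bool (size a = i \<and> size (m - a) = 2 * k - i))
        = (\<Sum>i\<le>2 * k. if i = size a then
            (- 1 :: rat) ^ size a * of_bool (size (m - a) = 2 * k - size a) else 0)"
      by (rule sum.cong) auto
    also have "\<dots> = of_bool (size m = 2 * k) * (- 1) ^ size a"
      using size by auto
    finally show "(\<Sum>i\<le>2 * k. (- 1) ^ i * of_bool (size a = i \<and> size (m - a) = 2 * k - i))
        = (of_bool (size m = 2 * k) * (- 1) ^ size a :: rat)" .
  qed
  also have "\<dots> = of_bool (size m = 2 * k \<and> m \<in> range (repeat_mset 2))"
    by (simp add: sum_signed_submultisets range_repeat_mset_2 flip: sum_distrib_left)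
  also have "\<dots> = mfps_coeff (adams 2 (?h k)) m"
  proof (cases "m \<in> range (repeat_mset 2)")
    case True
    then obtain m' where "m = repeat_mset 2 m'" by auto
    then show ?thesis by (simp add: adams_coeff_repeat complete_homogeneous_def)
  qed (simp add: adams_coeff_not_repeat)
  finally show "mfps_coeff (adams 2 (?h k)) m
      = mfps_coeff (\<Sum>i\<le>2 * k. (- 1) ^ i * ?h i * ?h (2 * k - i)) m" ..
qed

lemma complete_homogeneous_0: "complete_homogeneous 0 = 1"
  by (rule mfps_eqI) (simp add: complete_homogeneous_def mfps_coeff_one)

lemma power_sum_1: "power_sum (Suc 0) = complete_homogeneous 1"
  by (rule mfps_eqI) (auto simp: power_sum_def complete_homogeneous_def size_1_singleton_mset)

lemma replicate_mset_eq_repeat_mset: "replicate_mset k i = repeat_mset k {#i#}"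
  by (rule multiset_eqI) simp

text \<open>Seeing p_2 as p_2[h_1] lets the expansion of p_2[h_k] also express p_2 itself.\<close>

lemma power_sum_eq_adams: "power_sum 2 = adams 2 (complete_homogeneous 1)"
proof (rule mfps_eqI)
  fix m :: "nat multiset"
  show "mfps_coeff (power_sum 2) m = mfps_coeff (adams 2 (complete_homogeneous 1)) m"
  proof (cases "m \<in> range (repeat_mset 2)")
    case True
    then obtain m' where m: "m = repeat_mset 2 m'" by auto
    have "(\<exists>i. m = replicate_mset 2 i) \<longleftrightarrow> (\<exists>i. m' = {#i#})"
      unfolding m replicate_mset_eq_repeat_mset by (simp only: repeat_mset_inj[OF zero_less_numeral])
    moreover have "size m' = 1 \<longleftrightarrow> (\<exists>i. m' = {#i#})"
      using size_1_singleton_mset[of m'] by auto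
    ultimately show ?thesis
      by (simp add: m adams_coeff_repeat power_sum_def complete_homogeneous_def)
  next
    case False
    then have "\<not> (\<exists>i. m = replicate_mset 2 i)" 
      by (metis rangeI replicate_mset_eq_repeat_mset)
    with False show ?thesis by (simp add: adams_coeff_not_repeat power_sum_def)
  qed
qed

text \<open>The case \<open>k = 1\<close> of the expansion: h_0 h_2 - h_1 h_1 + h_2 h_0.\<close>

lemma power_sum_2: "power_sum 2 = 2 * complete_homogeneous 2 - complete_homogeneous 1 ^ 2"
  unfolding power_sum_eq_adams adams_2_complete_homogeneous
  by (simp add: numeral_2_eq_2 complete_homogeneous_0 algebra_simps)

lemma mfps_scale_half_double: "mfps_scale (1 / 2) (2 * f) = (f :: rat mfps)"
proof (rule mfps_eqI)
  fix m
  have "mfps_coeff (2 * f) m = 2 * mfps_coeff f m" by (simp only: mult_2 mfps_coeff_add)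
  then show "mfps_coeff (mfps_scale (1 / 2) (2 * f)) m = mfps_coeff f m" by simp
qed

lemma plethysm_complete_homogeneous_2:
  "plethysm (complete_homogeneous 2) g = mfps_scale (1 / 2) (g * g + adams 2 g)"
proof -
  \<comment> \<open>This encodes h_2 = (p_1^2 + p_2) / 2.\<close>
  define c :: "nat multiset \<Rightarrow>\<^sub>0 rat" where
    "c = Poly_Mapping.single {#Suc 0, Suc 0#} (1 / 2) + Poly_Mapping.single {#2#} (1 / 2)"
  have keys: "Poly_Mapping.keys c = {{#Suc 0, Suc 0#}, {#2#}}"
    by (auto simp: c_def in_keys_iff lookup_add lookup_single when_def split: if_splits)
  have ne: "{#Suc 0, Suc 0#} \<noteq> {#2::nat#}" by simp
  have lookup: "Poly_Mapping.lookup c {#Suc 0, Suc 0#} = 1 / 2" "Poly_Mapping.lookup c {#2#} = 1 / 2"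
    using ne by (auto simp: c_def lookup_add lookup_single when_def)
  have "power_sum_comb c = mfps_scale (1 / 2) (2 * complete_homogeneous 2)"
    unfolding power_sum_comb_def keys using ne
    by (auto simp: lookup power_sum_1 power_sum_2 power2_eq_square intro!: mfps_eqI)
       (simp add: diff_divide_distrib)
  then have "complete_homogeneous 2 = power_sum_comb c"
    by (simp add: mfps_scale_half_double)
  moreover have "\<forall>\<mu>\<in>Poly_Mapping.keys c. 0 \<notin># \<mu>" by (simp add: keys)
  ultimately have "power_sum_expansion (complete_homogeneous 2) = c"
    by (intro power_sum_expansion_eqI)
  then show ?thesis
    unfolding plethysm_def keys using ne
    by (auto simp: keys lookup adams_1 intro!: mfps_eqI)
qed


section \<open>Schur functions in finitely many variables\<close>

text \<open>Setting all variables from x_N on to zero is a ring homomorphism, and all these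
  restrictions together determine a series. After restriction a Schur function is a finite sum over
  tableaux, which opens the way to induction on \<open>N\<close>.\<close>

definition restrict_vars :: "nat \<Rightarrow> 'a::comm_ring_1 mfps \<Rightarrow> 'a mfps" where
  "restrict_vars N f = Abs_mfps (\<lambda>m. if set_mset m \<subseteq> {..<N} then mfps_coeff f m else 0)"

lemma mfps_coeff_restrict_vars:
  "mfps_coeff (restrict_vars N f) m = (if set_mset m \<subseteq> {..<N} then mfps_coeff f m else 0)"
  by (simp add: restrict_vars_def)

lemma restrict_vars_mult: "restrict_vars N (f * g) = restrict_vars N f * restrict_vars N g"
proof (rule mfps_eqI)
  fix m :: "nat multiset"
  have sub: "set_mset a \<subseteq> set_mset m \<and> set_mset (m - a) \<subseteq> set_mset m" if "a \<subseteq># m" for a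
    using that by (meson set_mset_mono in_diffD subsetI)
  show "mfps_coeff (restrict_vars N (f * g)) m
      = mfps_coeff (restrict_vars N f * restrict_vars N g) m"
  proof (cases "set_mset m \<subseteq> {..<N}")
    case True
    have "set_mset a \<subseteq> {..<N}" "set_mset (m - a) \<subseteq> {..<N}" if "a \<subseteq># m" for a
      using sub[OF that] True by blast+
    then have "mfps_coeff f a * mfps_coeff g (m - a)
        = mfps_coeff (restrict_vars N f) a * mfps_coeff (restrict_vars N g) (m - a)"
      if "a \<subseteq># m" for a
      using that by (simp add: mfps_coeff_restrict_vars)
    moreover have "mfps_coeff (restrict_vars N (f * g)) m = mfps_coeff (f * g) m"
      using True by (simp add: mfps_coeff_restrict_vars)
    ultimately show ?thesis
      by (simp add: mfps_coeff_mult)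
  next
    case False
    have "\<not> (set_mset a \<subseteq> {..<N} \<and> set_mset (m - a) \<subseteq> {..<N})" if "a \<subseteq># m" for a
    proof
      assume "set_mset a \<subseteq> {..<N} \<and> set_mset (m - a) \<subseteq> {..<N}"
      then have "set_mset (a + (m - a)) \<subseteq> {..<N}" by simp
      with False that show False by (simp add: subset_mset.add_diff_inverse)
    qed
    with False show ?thesis
      by (auto simp: mfps_coeff_mult mfps_coeff_restrict_vars intro!: sum.neutral)
  qed
qed

lemma comm_ring_hom_restrict_vars: "comm_ring_hom (restrict_vars N)"
  by unfold_locales
     (auto simp: restrict_vars_mult mfps_coeff_restrict_vars mfps_coeff_one intro!: mfps_eqI)

lemma restrict_vars_eqI:
  assumes "\<And>N. restrict_vars N f = restrict_vars N g"
  shows "f = g"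
proof (rule mfps_eqI)
  fix m :: "nat multiset"
  obtain N where "set_mset m \<subseteq> {..<N}"
    using finite_nat_iff_bounded[of "set_mset m"] by auto
  then show "mfps_coeff f m = mfps_coeff g m"
    using arg_cong[OF assms[of N], where f = "\<lambda>h. mfps_coeff h m"]
    by (simp add: mfps_coeff_restrict_vars)
qed

text \<open>Shapes with a fixed number of rows, empty rows allowed: the number of rows, and with it
  the size of the determinant, then stays the same when cells are removed.\<close>

definition cells :: "nat \<Rightarrow> (nat \<Rightarrow> nat) \<Rightarrow> (nat \<times> nat) set" where
  "cells r \<alpha> = (SIGMA i:{..<r}. {..<\<alpha> i})"

definition bounded_ssyt :: "nat \<Rightarrow> (nat \<times> nat) set \<Rightarrow> (nat \<times> nat \<Rightarrow> nat) set" where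
  "bounded_ssyt N D = {T \<in> D \<rightarrow>\<^sub>E {..<N}.
     (\<forall>i j j'. (i, j) \<in> D \<longrightarrow> (i, j') \<in> D \<longrightarrow> j < j' \<longrightarrow> T (i, j) \<le> T (i, j')) \<and>
     (\<forall>i i' j. (i, j) \<in> D \<longrightarrow> (i', j) \<in> D \<longrightarrow> i < i' \<longrightarrow> T (i, j) < T (i', j))}"

definition bounded_schur :: "nat \<Rightarrow> (nat \<times> nat) set \<Rightarrow> 'a::comm_ring_1 mfps" where
  "bounded_schur N D = (\<Sum>T\<in>bounded_ssyt N D. mfps_monom (image_mset T (mset_set D)))"

lemma finite_cells [simp]: "finite (cells r \<alpha>)"
  by (simp add: cells_def)

lemma mem_cells: "(i, j) \<in> cells r \<alpha> \<longleftrightarrow> i < r \<and> j < \<alpha> i"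
  by (simp add: cells_def)

lemma finite_bounded_ssyt [simp]: "finite D \<Longrightarrow> finite (bounded_ssyt N D)"
  unfolding bounded_ssyt_def by (rule finite_subset[of _ "D \<rightarrow>\<^sub>E {..<N}"]) (auto intro: finite_PiE)

lemma young_diagram_eq_cells: "young_diagram \<mu> = cells (length \<mu>) (\<lambda>i. rev \<mu> ! i)"
  by (auto simp: young_diagram_def cells_def)

lemma restrict_vars_schur: "restrict_vars N (schur \<mu>) = bounded_schur N (young_diagram \<mu>)"
proof (rule mfps_eqI)
  fix m :: "nat multiset"
  let ?D = "young_diagram \<mu>"
  let ?w = "\<lambda>T. image_mset T (mset_set ?D)"
  have fin: "finite ?D" by (simp add: young_diagram_eq_cells)
  have eq: "{T \<in> bounded_ssyt N ?D. m = ?w T}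
      = (if set_mset m \<subseteq> {..<N} then {T \<in> ssyt \<mu>. tableau_weight \<mu> T = m} else {})"
    using fin by (auto simp: bounded_ssyt_def ssyt_def tableau_weight_def PiE_def image_subset_iff)
  have "mfps_coeff (bounded_schur N ?D :: rat mfps) m
      = (\<Sum>T\<in>bounded_ssyt N ?D. of_bool (m = ?w T))"
    by (simp add: bounded_schur_def mfps_coeff_monom)
  also have "\<dots> = of_nat (card {T \<in> bounded_ssyt N ?D. m = ?w T})"
    using fin by (simp add: sum.If_cases Int_def of_bool_def)
  also have "\<dots> = mfps_coeff (restrict_vars N (schur \<mu>)) m"
    by (simp add: eq mfps_coeff_restrict_vars schur_def)
  finally show "mfps_coeff (restrict_vars N (schur \<mu>)) m
      = mfps_coeff (bounded_schur N ?D) m" by simp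
qed

section \<open>Horizontal strips and the branching rule\<close>

definition strip_floor :: "nat \<Rightarrow> (nat \<Rightarrow> nat) \<Rightarrow> nat \<Rightarrow> nat" where
  "strip_floor r \<alpha> i = (if Suc i < r then \<alpha> (Suc i) else 0)"

text \<open>The shapes left after deleting a horizontal strip: no deleted cell has another cell of
  \<alpha> below it.\<close>

definition interlacing :: "nat \<Rightarrow> (nat \<Rightarrow> nat) \<Rightarrow> (nat \<Rightarrow> nat) set" where
  "interlacing r \<alpha> = (\<Pi>\<^sub>E i\<in>{..<r}. {strip_floor r \<alpha> i..\<alpha> i})"

lemma finite_interlacing [simp]: "finite (interlacing r \<alpha>)"
  unfolding interlacing_def by (rule finite_PiE) auto

lemma interlacing_le: "\<beta> \<in> interlacing r \<alpha> \<Longrightarrow> i < r \<Longrightarrow> \<beta> i \<le> \<alpha> i"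
  unfolding interlacing_def by (drule PiE_mem[where x = i]) auto

lemma interlacing_ge: "\<beta> \<in> interlacing r \<alpha> \<Longrightarrow> Suc i < r \<Longrightarrow> \<alpha> (Suc i) \<le> \<beta> i"
  unfolding interlacing_def by (drule PiE_mem[where x = i]) (auto simp: strip_floor_def)

lemma interlacing_weakly_decreasing:
  assumes "\<beta> \<in> interlacing r \<alpha>" "Suc i < r"
  shows "\<beta> (Suc i) \<le> \<beta> i"
  using interlacing_le[OF assms] interlacing_ge[OF assms] by simp

text \<open>To be applied to the columns of a row with entry below \<open>N\<close>: they form an
  initial segment, so their number determines them.\<close>

lemma down_closed_eq_lessThan:
  fixes S :: "nat set"
  assumes "finite S" "\<And>i j. j \<in> S \<Longrightarrow> i < j \<Longrightarrow> i \<in> S"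
  shows "S = {..<card S}"
proof -
  obtain n where n: "S = {..<n}"
  proof (cases "S = {}")
    case False
    have "S = {..<Suc (Max S)}"
      using assms(2) Max_in[OF assms(1) False] Max_ge[OF assms(1)]
      by (auto simp: less_Suc_eq_le) (metis le_neq_implies_less)
    then show ?thesis using that by blast
  qed (use that[of 0] in auto)
  then show ?thesis by simp
qed

definition remove_largest :: "nat \<Rightarrow> nat \<Rightarrow> (nat \<Rightarrow> nat) \<Rightarrow> (nat \<times> nat \<Rightarrow> nat) \<Rightarrow> nat \<Rightarrow> nat" where
  "remove_largest r N \<alpha> T = (\<lambda>i\<in>{..<r}. card {j. j < \<alpha> i \<and> T (i, j) < N})"

lemma weakly_decreasing_le:
  assumes "\<And>i. Suc i < r \<Longrightarrow> \<alpha> (Suc i) \<le> (\<alpha> i :: nat)" "i \<le> i'" "i' < r"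
  shows "\<alpha> i' \<le> \<alpha> i"
  using assms(2,3)
proof (induction i' rule: dec_induct)
  case (step k)
  then show ?case using assms(1)[of k] by simp
qed simp

text \<open>In a column strict tableau the entries equal to the maximal value \<open>N\<close> sit
  at the ends of rows, at most one per column, hence form a horizontal strip. \<open>cut\<close>
  removes them and \<open>glue\<close> refills the strip with \<open>N\<close>; each removed cell
  accounts for one factor x_N.\<close>

lemma bounded_schur_branching:
  fixes \<alpha> :: "nat \<Rightarrow> nat"
  assumes dec: "\<And>i. Suc i < r \<Longrightarrow> \<alpha> (Suc i) \<le> \<alpha> i"
  shows "(bounded_schur (Suc N) (cells r \<alpha>) :: 'a::comm_ring_1 mfps)
     = (\<Sum>\<beta>\<in>interlacing r \<alpha>. mfps_monom {#N#} ^ (\<Sum>i<r. \<alpha> i - \<beta> i) * bounded_schur N (cells r \<beta>))"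
proof -
  let ?D = "cells r \<alpha>"
  let ?S = "\<lambda>\<beta>. bounded_ssyt N (cells r \<beta>)"
  let ?w = "\<lambda>D T. image_mset T (mset_set D)"
  define glue where "glue = (\<lambda>(\<beta>, T'). \<lambda>c\<in>?D. if c \<in> cells r \<beta> then T' c else N)"
  define cut where
    "cut = (\<lambda>T. (remove_largest r N \<alpha> T, restrict T (cells r (remove_largest r N \<alpha> T))))"
  have sub: "cells r \<beta> \<subseteq> ?D" if "\<beta> \<in> interlacing r \<alpha>" for \<beta>
    using interlacing_le[OF that] by (force simp: cells_def)
  have cell_iff: "(i, j) \<in> cells r (remove_largest r N \<alpha> T) \<longleftrightarrow> (i, j) \<in> ?D \<and> T (i, j) < N"
    if T: "T \<in> bounded_ssyt (Suc N) ?D" for T i j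
  proof (cases "i < r")
    case True
    let ?R = "{j. j < \<alpha> i \<and> T (i, j) < N}"
    have "?R = {..<card ?R}"
    proof (rule down_closed_eq_lessThan)
      fix j j' assume "j' \<in> ?R" "j < j'"
      moreover from this True have "T (i, j) \<le> T (i, j')"
        using T by (auto simp: bounded_ssyt_def mem_cells)
      ultimately show "j \<in> ?R" by simp
    qed simp
    then have "j < card ?R \<longleftrightarrow> j < \<alpha> i \<and> T (i, j) < N" by blast
    with True show ?thesis by (simp add: mem_cells remove_largest_def)
  qed (simp add: mem_cells)
  have cells_cut: "cells r (remove_largest r N \<alpha> T) = {c \<in> ?D. T c < N}"
    if "T \<in> bounded_ssyt (Suc N) ?D" for T
    using cell_iff[OF that] by auto
  have cut_in: "cut T \<in> (SIGMA \<beta>:interlacing r \<alpha>. ?S \<beta>)"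
    if T: "T \<in> bounded_ssyt (Suc N) ?D" for T
  proof -
    let ?\<beta> = "remove_largest r N \<alpha> T"
    have "?\<beta> i \<le> \<alpha> i" if "i < r" for i
      using that card_mono[of "{..<\<alpha> i}" "{j. j < \<alpha> i \<and> T (i, j) < N}"]
      by (auto simp: remove_largest_def)
    moreover have "\<alpha> (Suc i) \<le> ?\<beta> i" if i: "Suc i < r" for i
    proof (rule ccontr)
      \<comment> \<open>Then the cell in row \<open>i\<close> and column \<open>?\<beta> i\<close>
        has a cell below it, whose entry is at most \<open>N\<close>. So its own entry is below
        \<open>N\<close>, although it lies just past the kept part of its row.\<close>
      assume "\<not> \<alpha> (Suc i) \<le> ?\<beta> i"
      then have "(Suc i, ?\<beta> i) \<in> ?D" using i by (simp add: mem_cells)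
      moreover have "(i, ?\<beta> i) \<in> ?D" using i \<open>\<not> \<alpha> (Suc i) \<le> ?\<beta> i\<close> dec[OF i] by (simp add: mem_cells)
      ultimately have "T (i, ?\<beta> i) < T (Suc i, ?\<beta> i)" "T (Suc i, ?\<beta> i) < Suc N"
        using T by (auto simp: bounded_ssyt_def)
      then have "(i, ?\<beta> i) \<in> cells r ?\<beta>"
        using cell_iff[OF T] \<open>(i, ?\<beta> i) \<in> ?D\<close> by simp
      then show False by (simp add: mem_cells)
    qed
    ultimately have "?\<beta> \<in> interlacing r \<alpha>"
      by (auto simp: interlacing_def strip_floor_def remove_largest_def)
    moreover have "restrict T (cells r ?\<beta>) \<in> ?S ?\<beta>"
      using T unfolding bounded_ssyt_def by (auto simp: cells_cut[OF T] cell_iff[OF T])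
    ultimately show ?thesis by (simp add: cut_def)
  qed
  have glue_in: "glue (\<beta>, T') \<in> bounded_ssyt (Suc N) ?D"
    if \<beta>: "\<beta> \<in> interlacing r \<alpha>" and T': "T' \<in> ?S \<beta>" for \<beta> T'
  proof -
    let ?T = "glue (\<beta>, T')"
    have T'N: "T' c < N" if "c \<in> cells r \<beta>" for c
      using T' that by (auto simp: bounded_ssyt_def)
    have TD: "?T \<in> ?D \<rightarrow>\<^sub>E {..<Suc N}"
      by (rule PiE_I) (use T'N in \<open>simp_all add: glue_def less_Suc_eq\<close>)
    have "?T (i, j) \<le> ?T (i, j')" if "(i, j) \<in> ?D" "(i, j') \<in> ?D" "j < j'" for i j j'
    proof (cases "(i, j') \<in> cells r \<beta>")
      case True
      with that(3) have "(i, j) \<in> cells r \<beta>" by (auto simp: mem_cells)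
      with True that T' show ?thesis by (auto simp: glue_def bounded_ssyt_def)
    next
      case False
      with that T'N[of "(i, j)"] show ?thesis by (auto simp: glue_def)
    qed
    moreover have "?T (i, j) < ?T (i', j)" if c: "(i, j) \<in> ?D" "(i', j) \<in> ?D" "i < i'" for i i' j
    proof -
      \<comment> \<open>A cell with another cell below it is never in the strip, so of the two
        entries compared only the lower one can be the new \<open>N\<close>.\<close>
      have "\<alpha> i' \<le> \<alpha> (Suc i)"
        using weakly_decreasing_le[of r \<alpha> "Suc i" i'] dec c by (auto simp: mem_cells)
      then have "j < \<beta> i"
        using interlacing_ge[OF \<beta>, of i] c by (auto simp: mem_cells)
      then have ij: "(i, j) \<in> cells r \<beta>" using c by (auto simp: mem_cells)
      show ?thesis
      proof (cases "(i', j) \<in> cells r \<beta>")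
        case True
        with ij c T' show ?thesis by (auto simp: glue_def bounded_ssyt_def)
      next
        case False
        with ij c T'N[of "(i, j)"] show ?thesis by (simp add: glue_def)
      qed
    qed
    ultimately show ?thesis using TD unfolding bounded_ssyt_def by blast
  qed
  have glue_cut: "glue (cut T) = T" if T: "T \<in> bounded_ssyt (Suc N) ?D" for T
  proof
    fix c
    show "glue (cut T) c = T c"
    proof (cases "c \<in> ?D")
      case True
      then have "T c < Suc N" using T by (auto simp: bounded_ssyt_def)
      with True show ?thesis by (auto simp: glue_def cut_def cells_cut[OF T])
    next
      case False
      moreover have "T c = undefined"
        using T False by (auto simp: bounded_ssyt_def intro: PiE_arb)
      ultimately show ?thesis by (simp add: glue_def cut_def)
    qed
  qed
  have cut_glue: "cut (glue (\<beta>, T')) = (\<beta>, T')"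
    if \<beta>: "\<beta> \<in> interlacing r \<alpha>" and T': "T' \<in> ?S \<beta>" for \<beta> T'
  proof -
    let ?T = "glue (\<beta>, T')"
    have T'N: "T' c < N" if "c \<in> cells r \<beta>" for c
      using T' that by (auto simp: bounded_ssyt_def)
    have "{j. j < \<alpha> i \<and> ?T (i, j) < N} = {..<\<beta> i}" if "i < r" for i
    proof -
      have "?T (i, j) < N \<longleftrightarrow> j < \<beta> i" if "j < \<alpha> i" for j
        using that \<open>i < r\<close> T'N[of "(i, j)"] by (simp add: glue_def mem_cells)
      then show ?thesis using interlacing_le[OF \<beta> that] by auto
    qed
    moreover have "\<beta> i = undefined" if "\<not> i < r" for i
      using \<beta> that unfolding interlacing_def by (auto intro: PiE_arb)
    ultimately have b: "remove_largest r N \<alpha> ?T = \<beta>"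
      by (simp add: remove_largest_def restrict_def fun_eq_iff)
    have "T' c = undefined" if "c \<notin> cells r \<beta>" for c
      using T' that by (auto simp: bounded_ssyt_def intro: PiE_arb)
    then have "restrict ?T (cells r \<beta>) c = T' c" for c
      using sub[OF \<beta>] by (cases "c \<in> cells r \<beta>") (auto simp: glue_def)
    then have "restrict ?T (cells r \<beta>) = T'" by blast
    with b show ?thesis by (simp add: cut_def)
  qed
  have weight: "mfps_monom (?w ?D (glue (\<beta>, T')))
      = mfps_monom {#N#} ^ (\<Sum>i<r. \<alpha> i - \<beta> i) * (mfps_monom (?w (cells r \<beta>) T') :: 'a mfps)"
    if \<beta>: "\<beta> \<in> interlacing r \<alpha>" for \<beta> T'
  proof -
    let ?T = "glue (\<beta>, T')"
    have "?D - cells r \<beta> = (SIGMA i:{..<r}. {\<beta> i..<\<alpha> i})"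
      by (auto simp: cells_def)
    then have card: "card (?D - cells r \<beta>) = (\<Sum>i<r. \<alpha> i - \<beta> i)"
      by simp
    have "?D = (?D - cells r \<beta>) \<union> cells r \<beta>" using sub[OF \<beta>] by blast
    then have "mset_set ?D = mset_set (?D - cells r \<beta>) + mset_set (cells r \<beta>)"
      by (metis Diff_disjoint finite_Diff finite_cells inf_commute mset_set_Union)
    then have "?w ?D ?T = ?w (?D - cells r \<beta>) ?T + ?w (cells r \<beta>) ?T"
      by simp
    also have "?w (?D - cells r \<beta>) ?T = ?w (?D - cells r \<beta>) (\<lambda>_. N)"
      by (rule image_mset_cong) (auto simp: glue_def)
    also have "\<dots> = replicate_mset (\<Sum>i<r. \<alpha> i - \<beta> i) N"
      by (simp add: image_mset_const_eq card)
    also have "?w (cells r \<beta>) ?T = ?w (cells r \<beta>) T'"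
      using sub[OF \<beta>] by (intro image_mset_cong) (auto simp: glue_def)
    finally show ?thesis by (simp add: mfps_monom_add mfps_monom_replicate)
  qed
  have "(\<Sum>\<beta>\<in>interlacing r \<alpha>. mfps_monom {#N#} ^ (\<Sum>i<r. \<alpha> i - \<beta> i) * bounded_schur N (cells r \<beta>))
      = (\<Sum>(\<beta>, T')\<in>(SIGMA \<beta>:interlacing r \<alpha>. ?S \<beta>).
           mfps_monom {#N#} ^ (\<Sum>i<r. \<alpha> i - \<beta> i) * (mfps_monom (?w (cells r \<beta>) T') :: 'a mfps))"
    by (simp add: bounded_schur_def sum_distrib_left sum.Sigma)
  also have "\<dots> = (\<Sum>T\<in>bounded_ssyt (Suc N) ?D. mfps_monom (?w ?D T))"
  proof (rule sum.reindex_bij_witness[where i = cut and j = glue])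
    fix p assume "p \<in> (SIGMA \<beta>:interlacing r \<alpha>. ?S \<beta>)"
    then obtain \<beta> T' where p: "p = (\<beta>, T')" "\<beta> \<in> interlacing r \<alpha>" "T' \<in> ?S \<beta>"
      by blast
    show "cut (glue p) = p" "glue p \<in> bounded_ssyt (Suc N) ?D"
      using cut_glue glue_in p by auto
    show "mfps_monom (?w ?D (glue p)) = (case p of (\<beta>, T') \<Rightarrow>
        mfps_monom {#N#} ^ (\<Sum>i<r. \<alpha> i - \<beta> i) * (mfps_monom (?w (cells r \<beta>) T') :: 'a mfps))"
      using weight p by simp
  qed (use glue_cut cut_in in auto)
  finally show ?thesis by (simp add: bounded_schur_def)
qed


section \<open>The Jacobi--Trudi formula\<close>

text \<open>The extension by zero to negative indices makes the Jacobi--Trudi matrix uniform.\<close>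

definition hom_sym :: "int \<Rightarrow> rat mfps" where
  "hom_sym k = (if k < 0 then 0 else complete_homogeneous (nat k))"

text \<open>A monomial in x_0, ..., x_N either avoids x_N or is x_N times a monomial of degree one
  less.\<close>

lemma restrict_vars_hom_sym_Suc:
  "restrict_vars (Suc N) (hom_sym k)
     = restrict_vars N (hom_sym k) + mfps_monom {#N#} * restrict_vars (Suc N) (hom_sym (k - 1))"
proof (rule mfps_eqI)
  fix m :: "nat multiset"
  show "mfps_coeff (restrict_vars (Suc N) (hom_sym k)) m = mfps_coeff (restrict_vars N (hom_sym k)
     + mfps_monom {#N#} * restrict_vars (Suc N) (hom_sym (k - 1))) m"
  proof (cases "N \<in># m")
    case True
    then obtain m' where m: "m = add_mset N m'" by (metis insert_DiffM)
    have "set_mset m \<subseteq> {..<Suc N} \<longleftrightarrow> set_mset m' \<subseteq> {..<Suc N}" by (simp add: m)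
    moreover have "\<not> set_mset m \<subseteq> {..<N}" by (simp add: m)
    moreover have "int (size m') = k - 1 \<longleftrightarrow> int (size m) = k" by (auto simp: m)
    ultimately show ?thesis
      by (auto simp: mfps_coeff_monom_mult mfps_coeff_restrict_vars hom_sym_def
          complete_homogeneous_def m nat_eq_iff2 nat_eq_iff)
  next
    case False
    then have "set_mset m \<subseteq> {..<Suc N} \<longleftrightarrow> set_mset m \<subseteq> {..<N}"
      by (auto simp: subset_iff less_Suc_eq)
    with False show ?thesis
      by (simp add: mfps_coeff_monom_mult mfps_coeff_restrict_vars)
  qed
qed

lemma restrict_vars_0_hom_sym: "restrict_vars 0 (hom_sym k) = of_bool (k = 0)"
  by (rule mfps_eqI)
     (auto simp: mfps_coeff_restrict_vars hom_sym_def complete_homogeneous_def mfps_coeff_one)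

text \<open>The sequence \<open>h\<close> is a parameter so that the restrictions of
  \<open>hom_sym\<close> to different numbers of variables can be inserted.\<close>

definition jacobi_trudi :: "(int \<Rightarrow> 'a::comm_ring_1) \<Rightarrow> nat \<Rightarrow> (nat \<Rightarrow> nat) \<Rightarrow> 'a" where
  "jacobi_trudi h r \<alpha> = det (mat r r (\<lambda>(i, j). h (int (\<alpha> i) + int j - int i)))"

text \<open>Substituting \<open>f k = g k - x * g (k - 1)\<close> makes the sum telescope; only its
  two ends survive.\<close>

lemma jacobi_trudi_row_sum:
  fixes f g :: "int \<Rightarrow> 'a::comm_ring_1"
  assumes rec: "\<And>k. g k = f k + x * g (k - 1)" and "l \<le> a"
  shows "(\<Sum>b=l..a. x ^ (a - b) * f (int b + c)) = g (int a + c) - x ^ (Suc a - l) * g (int l - 1 + c)"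
  using \<open>l \<le> a\<close>
proof (induction a rule: dec_induct)
  case base
  show ?case using rec[of "int l + c"] by (simp add: algebra_simps)
next
  case (step a)
  have "(\<Sum>b=l..a. x ^ (Suc a - b) * f (int b + c)) = x * (\<Sum>b=l..a. x ^ (a - b) * f (int b + c))"
    by (auto simp: sum_distrib_left Suc_diff_le mult.assoc intro!: sum.cong)
  then have "(\<Sum>b=l..Suc a. x ^ (Suc a - b) * f (int b + c))
      = x * (g (int a + c) - x ^ (Suc a - l) * g (int l - 1 + c)) + f (int (Suc a) + c)"
    using step by simp
  also have "\<dots> = g (int (Suc a) + c) - x ^ (Suc (Suc a) - l) * g (int l - 1 + c)"
    using rec[of "int (Suc a) + c"] step by (simp add: Suc_diff_le algebra_simps)
  finally show ?case .
qed

text \<open>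
  Summing each row of the matrix over its interlacing interval telescopes to the difference of
  the corresponding row for \<open>g\<close> and a multiple of the next one, so the determinant does not change.
\<close>

lemma jacobi_trudi_branching:
  fixes f g :: "int \<Rightarrow> 'a::comm_ring_1"
  assumes rec: "\<And>k. g k = f k + x * g (k - 1)" and neg: "\<And>k. k < 0 \<Longrightarrow> g k = 0"
    and dec: "\<And>i. Suc i < r \<Longrightarrow> \<alpha> (Suc i) \<le> \<alpha> i"
  shows "jacobi_trudi g r \<alpha> = (\<Sum>\<beta>\<in>interlacing r \<alpha>. x ^ (\<Sum>i<r. \<alpha> i - \<beta> i) * jacobi_trudi f r \<beta>)"
proof -
  let ?B = "\<lambda>i. {strip_floor r \<alpha> i..\<alpha> i}"
  let ?u = "\<lambda>i. x ^ (Suc (\<alpha> i) - strip_floor r \<alpha> i)"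
  define G where "G = mat r r (\<lambda>(i, j). g (int (\<alpha> i) + int j - int i))"
  \<comment> \<open>Multiplication by this unitriangular matrix performs the row operations, each
    row being corrected by a multiple of the next.\<close>
  define U where "U = mat r r (\<lambda>(i, j). if i = j then 1 else if j = Suc i then - ?u i else 0)"
  define E where "E = (\<lambda>i j. \<Sum>b\<in>?B i. x ^ (\<alpha> i - b) * f (int b + int j - int i))"
  have "upper_triangular U" by (auto simp: U_def upper_triangular_def)
  then have "det U = prod_list (diag_mat U)"
    by (rule det_upper_triangular[of _ r]) (simp add: U_def)
  also have "\<dots> = 1"
    unfolding prod_list_diag_prod by (rule prod.neutral) (simp add: U_def)
  finally have det_U: "det U = 1" .
  have "U * G = mat r r (\<lambda>(i, j). E i j)"
  proof (rule eq_matI)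
    fix i j assume "i < dim_row (mat r r (\<lambda>(i, j). E i j))" "j < dim_col (mat r r (\<lambda>(i, j). E i j))"
    then have ij: "i < r" "j < r" by auto
    let ?G = "\<lambda>k. g (int (\<alpha> k) + int j - int k)"
    have "(U * G) $$ (i, j) = (\<Sum>k = 0..<r. (if i = k then 1 else if k = Suc i then - ?u i else 0) * ?G k)"
      using ij by (simp add: U_def G_def scalar_prod_def)
    also have "\<dots> = (\<Sum>k = 0..<r. (if k = i then ?G k else 0) + (if k = Suc i then - ?u i * ?G k else 0))"
      by (rule sum.cong) auto
    also have "\<dots> = ?G i - (if Suc i < r then ?u i * ?G (Suc i) else 0)"
      using ij by (simp add: sum.distrib)
    \<comment> \<open>In the last row there is no next row to subtract; there the lower bound is 0
      and the index \<open>j - i - 1\<close> is negative, so \<open>g\<close> vanishes.\<close>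
    also have "(if Suc i < r then ?u i * ?G (Suc i) else 0)
        = ?u i * g (int (strip_floor r \<alpha> i) - 1 + (int j - int i))"
      using ij neg[of "int j - (1 + int i)"] by (auto simp: strip_floor_def algebra_simps)
    also have "?G i - \<dots> = E i j"
    proof -
      have "strip_floor r \<alpha> i \<le> \<alpha> i" using dec by (simp add: strip_floor_def)
      from jacobi_trudi_row_sum[of g f x, OF rec this, of "int j - int i"] show ?thesis
        by (simp add: E_def algebra_simps)
    qed
    finally show "(U * G) $$ (i, j) = mat r r (\<lambda>(i, j). E i j) $$ (i, j)" using ij by simp
  qed (auto simp: U_def G_def)
  then have "det (mat r r (\<lambda>(i, j). E i j)) = det U * det G"
    using det_mult[of U r G] by (simp add: G_def U_def)
  then have "jacobi_trudi g r \<alpha> = det (mat r r (\<lambda>(i, j). E i j))"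
    by (simp add: det_U jacobi_trudi_def G_def)
  also have "\<dots> = (\<Sum>p | p permutes {0..<r}. signof p * (\<Prod>i = 0..<r. E i (p i)))"
    by (auto simp: det_def'[of _ r] permutes_in_image intro!: sum.cong prod.cong)
  \<comment> \<open>Picking one summand from each row sum amounts to choosing an interlacing
    \<beta>.\<close>
  also have "\<dots> = (\<Sum>p | p permutes {0..<r}. signof p *
      (\<Sum>\<beta>\<in>interlacing r \<alpha>. \<Prod>i = 0..<r. x ^ (\<alpha> i - \<beta> i) * f (int (\<beta> i) + int (p i) - int i)))"
    unfolding E_def interlacing_def lessThan_atLeast0 by (simp add: prod_sum_PiE)
  also have "\<dots> = (\<Sum>\<beta>\<in>interlacing r \<alpha>. \<Sum>p | p permutes {0..<r}. signof p *
      (\<Prod>i = 0..<r. x ^ (\<alpha> i - \<beta> i) * f (int (\<beta> i) + int (p i) - int i)))"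
    by (subst sum.swap) (simp add: sum_distrib_left)
  also have "\<dots> = (\<Sum>\<beta>\<in>interlacing r \<alpha>. x ^ (\<Sum>i<r. \<alpha> i - \<beta> i) * jacobi_trudi f r \<beta>)"
  proof (rule sum.cong[OF refl])
    fix \<beta>
    have "jacobi_trudi f r \<beta>
        = (\<Sum>p | p permutes {0..<r}. signof p * (\<Prod>i = 0..<r. f (int (\<beta> i) + int (p i) - int i)))"
      by (auto simp: jacobi_trudi_def det_def'[of _ r] permutes_in_image intro!: sum.cong prod.cong)
    then show "(\<Sum>p | p permutes {0..<r}. signof p *
        (\<Prod>i = 0..<r. x ^ (\<alpha> i - \<beta> i) * f (int (\<beta> i) + int (p i) - int i)))
      = x ^ (\<Sum>i<r. \<alpha> i - \<beta> i) * jacobi_trudi f r \<beta>"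
      by (simp add: prod.distrib power_sum sum_distrib_left mult.left_commute lessThan_atLeast0)
  qed
  finally show ?thesis .
qed

lemma bounded_ssyt_0: "bounded_ssyt 0 D = (if D = {} then {\<lambda>_. undefined} else {})"
  by (auto simp: bounded_ssyt_def)

text \<open>Both sides obey the same branching recursion in the number of variables. Without
  variables h_k is 1 for \<open>k = 0\<close> and 0 otherwise, which leaves the identity matrix for
  the empty shape.\<close>

lemma bounded_schur_eq_jacobi_trudi:
  assumes "\<And>i. Suc i < r \<Longrightarrow> \<alpha> (Suc i) \<le> \<alpha> i"
  shows "bounded_schur N (cells r \<alpha>) = jacobi_trudi (\<lambda>k. restrict_vars N (hom_sym k)) r \<alpha>"
  using assms
proof (induction N arbitrary: \<alpha>)
  case 0
  let ?M = "mat r r (\<lambda>(i, j). of_bool (int (\<alpha> i) + int j - int i = 0)) :: rat mfps mat"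
  have jt: "jacobi_trudi (\<lambda>k. restrict_vars 0 (hom_sym k)) r \<alpha> = det ?M"
    by (simp add: jacobi_trudi_def restrict_vars_0_hom_sym)
  show ?case
  proof (cases "cells r \<alpha> = {}")
    case True
    then have "\<alpha> i = 0" if "i < r" for i
      using that by (auto simp: cells_def)
    then have "?M = 1\<^sub>m r" by (intro eq_matI) auto
    then show ?thesis using True jt by (simp add: bounded_schur_def bounded_ssyt_0 mfps_monom_empty)
  next
    case False
    then obtain i j where "(i, j) \<in> cells r \<alpha>" by auto
    then have i: "i < r" "0 < \<alpha> i" by (auto simp: mem_cells)
    \<comment> \<open>All indices \<open>\<alpha> 0 + j\<close> in the first row are positive, so
      the row vanishes and with it the determinant.\<close>
    then have "0 < \<alpha> 0" using weakly_decreasing_le[of r \<alpha> 0 i] 0 by simp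
    then have "?M $$ (0, p 0) = 0" if "p permutes {0..<r}" for p
      using that i permutes_in_image[OF that, of 0] by auto
    moreover have "0 \<in> {0..<r}" using i by simp
    ultimately have "(\<Prod>i = 0..<r. ?M $$ (i, p i)) = 0" if "p permutes {0..<r}" for p
      using that by (intro prod_zero) blast+
    then have "det ?M = 0" by (subst det_def'[of _ r]) auto
    then show ?thesis using False jt by (simp add: bounded_schur_def bounded_ssyt_0)
  qed
next
  case (Suc N)
  have neg: "restrict_vars (Suc N) (hom_sym k) = 0" if "k < 0" for k
    using that by (auto simp: hom_sym_def mfps_coeff_restrict_vars intro!: mfps_eqI)
  have "bounded_schur N (cells r \<beta>) = jacobi_trudi (\<lambda>k. restrict_vars N (hom_sym k)) r \<beta>"
    if "\<beta> \<in> interlacing r \<alpha>" for \<beta>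
    using interlacing_weakly_decreasing[OF that] by (intro Suc.IH)
  then show ?case
    by (simp add: bounded_schur_branching[of r \<alpha>, OF Suc.prems]
        jacobi_trudi_branching[of "\<lambda>k. restrict_vars (Suc N) (hom_sym k)"
          "\<lambda>k. restrict_vars N (hom_sym k)" "mfps_monom {#N#}" r \<alpha>, OF
          restrict_vars_hom_sym_Suc neg Suc.prems])
qed

lemma schur_eq_jacobi_trudi:
  assumes "sorted \<mu>"
  shows "schur \<mu> = jacobi_trudi hom_sym (length \<mu>) (\<lambda>i. rev \<mu> ! i)"
proof (rule restrict_vars_eqI)
  fix N
  interpret comm_ring_hom "restrict_vars N :: rat mfps \<Rightarrow> rat mfps"
    by (rule comm_ring_hom_restrict_vars)
  let ?\<alpha> = "\<lambda>i. rev \<mu> ! i" and ?r = "length \<mu>"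
  have dec: "?\<alpha> (Suc i) \<le> ?\<alpha> i" if "Suc i < ?r" for i
    using assms that by (simp add: rev_nth sorted_nth_mono)
  have "restrict_vars N (jacobi_trudi hom_sym ?r ?\<alpha>)
      = det (map_mat (restrict_vars N) (mat ?r ?r (\<lambda>(i, j). hom_sym (int (?\<alpha> i) + int j - int i))))"
    by (simp add: jacobi_trudi_def)
  also have "map_mat (restrict_vars N) (mat ?r ?r (\<lambda>(i, j). hom_sym (int (?\<alpha> i) + int j - int i)))
      = mat ?r ?r (\<lambda>(i, j). restrict_vars N (hom_sym (int (?\<alpha> i) + int j - int i)))"
    by (rule eq_matI) auto
  also have "det \<dots> = bounded_schur N (cells ?r ?\<alpha>)"
    using bounded_schur_eq_jacobi_trudi[of ?r ?\<alpha>, OF dec] by (simp add: jacobi_trudi_def)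
  also have "\<dots> = restrict_vars N (schur \<mu>)"
    by (simp add: restrict_vars_schur young_diagram_eq_cells)
  finally show "restrict_vars N (schur \<mu>) = restrict_vars N (jacobi_trudi hom_sym ?r ?\<alpha>)" ..
qed


section \<open>Pieri rules and the plethysm\<close>

text \<open>Laplace expansion along the first row, with the minors again given by explicit entry
  functions, so that rewriting can unfold determinants of fixed size completely.\<close>

lemma det_mat_Suc:
  "det (mat (Suc n) (Suc n) (\<lambda>(i, j). F i j) :: 'a::comm_ring_1 mat)
     = (\<Sum>j<Suc n. F 0 j * ((- 1) ^ j * det (mat n n (\<lambda>(i, k). F (Suc i) (if k < j then k else Suc k)))))"
proof -
  let ?A = "mat (Suc n) (Suc n) (\<lambda>(i, j). F i j)"
  have "mat_delete ?A 0 j = mat n n (\<lambda>(i, k). F (Suc i) (if k < j then k else Suc k))" for j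
    by (rule eq_matI) (auto simp: mat_delete_def)
  then show ?thesis
    using laplace_expansion_row[of ?A "Suc n" 0] by (simp add: cofactor_def)
qed

lemma hom_sym_of_nat: "hom_sym (int k) = complete_homogeneous k"
  by (simp add: hom_sym_def)

lemma hom_sym_0 [simp]: "hom_sym 0 = 1"
  by (simp add: hom_sym_def complete_homogeneous_0)

lemma hom_sym_neg [simp]: "k < 0 \<Longrightarrow> hom_sym k = 0"
  by (simp add: hom_sym_def)

text \<open>
  Expanded Jacobi--Trudi determinants for the shapes with parts \<open>(k, l)\<close>, \<open>(c, k, l)\<close> and
  \<open>(1, 1, k, l)\<close>. As functions of arbitrary integers they satisfy the Pieri rules without side
  conditions: terms that are not partitions vanish or cancel.
\<close>

definition schur2 :: "int \<Rightarrow> int \<Rightarrow> rat mfps" where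
  "schur2 l k = hom_sym l * hom_sym k - hom_sym (l + 1) * hom_sym (k - 1)"

definition schur3 :: "int \<Rightarrow> int \<Rightarrow> int \<Rightarrow> rat mfps" where
  "schur3 l k c = hom_sym c * schur2 l k
     - hom_sym (c - 1) * (hom_sym l * hom_sym (k + 1) - hom_sym (l + 2) * hom_sym (k - 1))
     + hom_sym (c - 2) * schur2 (l + 1) (k + 1)"

definition schur_1_1 :: "int \<Rightarrow> int \<Rightarrow> rat mfps" where
  "schur_1_1 l k = (hom_sym 1 ^ 2 - hom_sym 2) * schur2 l k
     - hom_sym 1 * (hom_sym l * hom_sym (k + 1) - hom_sym (l + 2) * hom_sym (k - 1))
     + (hom_sym l * hom_sym (k + 2) - hom_sym (l + 3) * hom_sym (k - 1))"

lemma schur_singleton: "schur [a] = hom_sym (int a)"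
  by (simp add: schur_eq_jacobi_trudi jacobi_trudi_def det_mat_Suc)

lemma schur_pair: "a \<le> b \<Longrightarrow> schur [a, b] = schur2 (int b) (int a)"
  by (simp add: schur_eq_jacobi_trudi jacobi_trudi_def det_mat_Suc schur2_def algebra_simps)

lemma schur_triple: "c \<le> a \<Longrightarrow> a \<le> b \<Longrightarrow> schur [c, a, b] = schur3 (int b) (int a) (int c)"
  by (simp add: schur_eq_jacobi_trudi jacobi_trudi_def det_mat_Suc schur3_def schur2_def algebra_simps)

lemma schur_quadruple: "1 \<le> a \<Longrightarrow> a \<le> b \<Longrightarrow> schur [1, 1, a, b] = schur_1_1 (int b) (int a)"
  by (simp add: schur_eq_jacobi_trudi jacobi_trudi_def det_mat_Suc schur_1_1_def schur2_def
      power2_eq_square algebra_simps)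

lemma pieri_horizontal:
  "hom_sym 2 * schur2 l k = schur2 (l + 2) k + schur2 (l + 1) (k + 1) + schur2 l (k + 2)
     + schur3 (l + 1) k 1 + schur3 l (k + 1) 1 + schur3 l k 2"
  by (simp add: schur2_def schur3_def algebra_simps)

text \<open>The first factor is the elementary symmetric function e_2, so two cells are added in
  different rows.\<close>

lemma pieri_vertical:
  "(hom_sym 1 ^ 2 - hom_sym 2) * schur2 l k = schur2 (l + 1) (k + 1)
     + schur3 (l + 1) k 1 + schur3 l (k + 1) 1 + schur_1_1 l k"
  by (simp add: schur2_def schur3_def schur_1_1_def power2_eq_square algebra_simps)

section \<open>Telescoping and reduction to Pieri products\<close>

lemma telescope_sum:
  fixes P :: "int \<Rightarrow> 'a::comm_ring_1"
  assumes "P (- 1) = 0"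
  shows "(\<Sum>k\<le>m. P (int k) - P (int k - 1)) = P (int m)"
  using assms by (induction m) auto

text \<open>Both sides equal twice the signed sum of \<open>P\<close> below \<open>m\<close> plus
  the signed middle term: the left by summation by parts, the right by the reflection of
  \<open>i\<close> to \<open>2 * m - i\<close>, which preserves parity.\<close>

lemma signed_telescope_sum:
  fixes P :: "int \<Rightarrow> 'a::comm_ring_1"
  assumes "P (- 1) = 0" and sym: "\<And>i. P (2 * int m - i) = P i"
  shows "(\<Sum>k\<le>m. (- 1) ^ k * (P (int k) - P (int k - 1))) = (\<Sum>i\<le>2 * m. (- 1) ^ i * P (int i))"
proof -
  let ?f = "\<lambda>i. (- 1) ^ i * P (int i)"
  have "(\<Sum>i\<in>{Suc m..2 * m}. ?f i) = (\<Sum>i<m. ?f i)"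
  proof (rule sum.reindex_bij_witness[where i = "\<lambda>i. 2 * m - i" and j = "\<lambda>i. 2 * m - i"])
    fix i assume i: "i \<in> {Suc m..2 * m}"
    then have "(- 1 :: 'a) ^ (2 * m - i) = (- 1) ^ i"
      by (simp add: minus_one_power_iff)
    moreover have "int (2 * m - i) = 2 * int m - int i" using i by auto
    ultimately show "?f (2 * m - i) = ?f i" by (simp only: sym)
  qed auto
  moreover have "(\<Sum>i\<le>2 * m. ?f i) = (\<Sum>i<m. ?f i) + (?f m + (\<Sum>i\<in>{Suc m..2 * m}. ?f i))"
  proof -
    have "{..2 * m} = {..<m} \<union> {m..2 * m}" by auto
    then have "(\<Sum>i\<le>2 * m. ?f i) = (\<Sum>i<m. ?f i) + (\<Sum>i\<in>{m..2 * m}. ?f i)"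
      by (subst sum.union_disjoint[symmetric]) auto
    also have "(\<Sum>i\<in>{m..2 * m}. ?f i) = ?f m + (\<Sum>i\<in>{Suc m..2 * m}. ?f i)"
      by (rule sum.atLeast_Suc_atMost) simp
    finally show ?thesis .
  qed
  \<comment> \<open>The bound \<open>M\<close> is separate from \<open>m\<close> because the
    symmetry of \<open>P\<close> about \<open>m\<close> must stay fixed during the
    induction.\<close>
  moreover have "(\<Sum>k\<le>M. (- 1) ^ k * (P (int k) - P (int k - 1))) = 2 * (\<Sum>i<M. ?f i) + ?f M" for M
    using assms(1) by (induction M) (auto simp: algebra_simps)
  ultimately show ?thesis by simp
qed

text \<open>The two-row determinant is a difference of consecutive values of
  \<open>P\<close>.\<close>

lemma sum_schur2:
  "(\<Sum>k\<le>m. schur2 (int (2 * m) - int k) (int k)) = complete_homogeneous m * complete_homogeneous m"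
proof -
  define P where "P = (\<lambda>i. hom_sym (2 * int m - i) * hom_sym i)"
  have "(\<Sum>k\<le>m. schur2 (int (2 * m) - int k) (int k)) = (\<Sum>k\<le>m. P (int k) - P (int k - 1))"
    by (simp add: schur2_def P_def algebra_simps)
  also have "\<dots> = P (int m)" by (rule telescope_sum) (simp add: P_def)
  finally show ?thesis by (simp add: P_def flip: hom_sym_of_nat)
qed

lemma signed_sum_schur2:
  "(\<Sum>k\<le>m. (- 1) ^ k * schur2 (int (2 * m) - int k) (int k)) = adams 2 (complete_homogeneous m)"
proof -
  define P where "P = (\<lambda>i. hom_sym (2 * int m - i) * hom_sym i)"
  have "(\<Sum>k\<le>m. (- 1) ^ k * schur2 (int (2 * m) - int k) (int k))
      = (\<Sum>k\<le>m. (- 1) ^ k * (P (int k) - P (int k - 1)))"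
    by (simp add: schur2_def P_def algebra_simps)
  also have "\<dots> = (\<Sum>i\<le>2 * m. (- 1) ^ i * P (int i))"
    by (rule signed_telescope_sum) (simp_all add: P_def mult.commute)
  also have "\<dots> = adams 2 (complete_homogeneous m)"
    unfolding adams_2_complete_homogeneous
    by (auto simp: P_def mult_ac simp flip: hom_sym_of_nat intro!: sum.cong)
  finally show ?thesis .
qed

lemma plethysm_eq_sum_products:
  "plethysm (complete_homogeneous 2) (complete_homogeneous 1 * complete_homogeneous m)
     = (\<Sum>k\<le>m. (if even k then hom_sym 2 else hom_sym 1 ^ 2 - hom_sym 2)
          * schur2 (int (2 * m) - int k) (int k))"
proof -
  let ?h = complete_homogeneous and ?s = "\<lambda>k. schur2 (int (2 * m) - int k) (int k)"
  have h: "?h 1 = hom_sym 1" "?h 2 = hom_sym 2"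
    by (simp_all add: hom_sym_def)
  have "(?h 1 * ?h m) * (?h 1 * ?h m) + adams 2 (?h 1 * ?h m)
      = hom_sym 1 ^ 2 * (\<Sum>k\<le>m. ?s k) + (2 * hom_sym 2 - hom_sym 1 ^ 2) * (\<Sum>k\<le>m. (- 1) ^ k * ?s k)"
    unfolding sum_schur2 signed_sum_schur2
    using h power_sum_2 by (simp add: power_sum_eq_adams adams_mult power2_eq_square mult_ac)
  also have "\<dots> = (\<Sum>k\<le>m. hom_sym 1 ^ 2 * ?s k + (2 * hom_sym 2 - hom_sym 1 ^ 2) * ((- 1) ^ k * ?s k))"
    by (simp add: sum_distrib_left sum.distrib)
  \<comment> \<open>The factors h_1^2 and 2 h_2 - h_1^2 add up to 2 h_2 for even \<open>k\<close>;
    their difference is 2 (h_1^2 - h_2) for odd \<open>k\<close>.\<close>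
  also have "\<dots> = 2 * (\<Sum>k\<le>m. (if even k then hom_sym 2 else hom_sym 1 ^ 2 - hom_sym 2) * ?s k)"
    unfolding sum_distrib_left
    by (rule sum.cong) (auto simp: minus_one_power_iff algebra_simps)
  finally show ?thesis
    by (simp add: plethysm_complete_homogeneous_2 mfps_scale_half_double)
qed

lemma sum_Collect_Suc:
  fixes f :: "nat \<Rightarrow> 'a::comm_monoid_add"
  assumes "b \<le> Suc M"
  shows "(\<Sum>a | b \<le> a \<and> a \<le> Suc M \<and> P a. f a)
     = (\<Sum>a | b \<le> a \<and> a \<le> M \<and> P a. f a) + (if P (Suc M) then f (Suc M) else 0)"
proof -
  have "{a. b \<le> a \<and> a \<le> Suc M \<and> P a}
      = {a. b \<le> a \<and> a \<le> M \<and> P a} \<union> (if P (Suc M) then {Suc M} else {})"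
    using assms by (auto simp: le_Suc_eq)
  moreover have "finite {a. b \<le> a \<and> a \<le> M \<and> P a}"
    by (rule finite_subset[of _ "{..M}"]) auto
  ultimately show ?thesis by (simp add: add.commute)
qed

text \<open>Away from the ends, \<open>U a\<close> comes from \<open>k = a\<close>,
  \<open>a - 1\<close> and \<open>a - 2\<close> if \<open>a\<close> is even but only from
  \<open>k = a - 1\<close> if \<open>a\<close> is odd, and \<open>T a\<close> comes from
  \<open>k = a\<close> and \<open>k = a - 1\<close>. The remaining terms are the contributions at
  the two ends of the range.\<close>

lemma sum_pieri_terms:
  fixes U T V W :: "nat \<Rightarrow> 'a::comm_ring_1"
  assumes "1 \<le> M"
  shows "(\<Sum>k\<le>M. if even k then U k + U (k + 1) + U (k + 2) + T k + T (k + 1) + V k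
            else U (k + 1) + T k + T (k + 1) + W k)
     = (\<Sum>a | 1 \<le> a \<and> a \<le> M \<and> odd a. W a) + (\<Sum>a | 2 \<le> a \<and> a \<le> M \<and> even a. V a) + V 0
     + T 0 + 2 * T 1 + (\<Sum>a | 2 \<le> a \<and> a \<le> M. 2 * T a) + T (M + 1)
     + U 0 + U 1 + (\<Sum>a | 2 \<le> a \<and> a \<le> M \<and> even a. 3 * U a) + (\<Sum>a | 2 \<le> a \<and> a \<le> M \<and> odd a. U a)
     + (if even M then U (M + 1) + U (M + 2) else 2 * U (M + 1))"
  using assms
proof (induction M rule: dec_induct)
  case base
  have "(\<Sum>a | 2 \<le> a \<and> a \<le> 1 \<and> P a. f a) = 0" "(\<Sum>a | 2 \<le> a \<and> a \<le> 1. f a) = 0"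
    for f :: "nat \<Rightarrow> 'a" and P
    by (auto intro!: sum.neutral)
  moreover have "(\<Sum>a | 1 \<le> a \<and> a \<le> 1 \<and> odd a. W a) = W 1"
  proof -
    have "{a. 1 \<le> a \<and> a \<le> 1 \<and> odd a} = {1 :: nat}" by auto
    then show ?thesis by simp
  qed
  moreover have "{..1} = {0, 1 :: nat}" by auto
  ultimately show ?case by (simp only:) (simp add: numeral_2_eq_2 algebra_simps)
next
  case (step M)
  note Suc = sum_Collect_Suc[where M = M]
  have all: "(\<Sum>a | 2 \<le> a \<and> a \<le> Suc M. 2 * T a) = (\<Sum>a | 2 \<le> a \<and> a \<le> M. 2 * T a) + 2 * T (Suc M)"
    using Suc[where b = 2 and P = "\<lambda>_. True" and f = "\<lambda>a. 2 * T a"] step.hyps by simp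
  show ?case
    unfolding sum.atMost_Suc step.IH all
    using step.hyps by (subst (1 2 3 4) Suc) (auto simp: algebra_simps)
qed

theorem theorem7p5:
  fixes n :: nat
  assumes "n \<ge> 3"
  shows "plethysm (complete_homogeneous 2)
           (complete_homogeneous 1 * complete_homogeneous (n - 1)) =
      (\<Sum>a | 1 \<le> a \<and> a \<le> n - 1 \<and> odd a. schur [1, 1, a, 2 * n - 2 - a])
    + (\<Sum>a | 2 \<le> a \<and> a \<le> n - 1 \<and> even a. schur [2, a, 2 * n - 2 - a])
    + schur [1, 1, 2 * n - 2]
    + (\<Sum>a | 2 \<le> a \<and> a \<le> n - 1. 2 * schur [1, a, 2 * n - 1 - a])
    + schur [1, 2 * n - 1]
    + (\<Sum>a | 2 \<le> a \<and> a \<le> n - 1 \<and> even a. 3 * schur [a, 2 * n - a])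
    + (\<Sum>a | 2 \<le> a \<and> a \<le> n - 1 \<and> odd a. schur [a, 2 * n - a])
    + 2 * of_bool (even n) * schur [n, n]
    + schur [2 * n]"
proof -
  define m where "m = n - 1"
  have n: "n = m + 1" "1 \<le> m" using assms by (auto simp: m_def)
  \<comment> \<open>All four families have total size \<open>2 * n\<close>: \<open>U\<close> has two
    rows, the others a two-row shape extended by 1, by 2, or by 1 and 1.\<close>
  define U where "U = (\<lambda>k. schur2 (int (2 * m) + 2 - int k) (int k))"
  define T where "T = (\<lambda>k. schur3 (int (2 * m) + 1 - int k) (int k) 1)"
  define V where "V = (\<lambda>k. schur3 (int (2 * m) - int k) (int k) 2)"
  define W where "W = (\<lambda>k. schur_1_1 (int (2 * m) - int k) (int k))"
  have W: "schur [1, 1, a, 2 * n - 2 - a] = W a" if "1 \<le> a" "a \<le> m" for a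
    using that n schur_quadruple[of a "2 * n - 2 - a"] by (simp add: W_def)
  have V: "schur [2, a, 2 * n - 2 - a] = V a" if "2 \<le> a" "a \<le> m" for a
    using that n schur_triple[of 2 a "2 * n - 2 - a"] by (simp add: V_def)
  have T: "schur [1, a, 2 * n - 1 - a] = T a" if "1 \<le> a" "a \<le> m" for a
    using that n schur_triple[of 1 a "2 * n - 1 - a"] by (simp add: T_def algebra_simps)
  have U: "schur [a, 2 * n - a] = U a" if "1 \<le> a" "a \<le> n" for a
    using that n schur_pair[of a "2 * n - a"] by (simp add: U_def algebra_simps)
  have U0: "schur [2 * n] = U 0"
    using n by (simp add: schur_singleton U_def schur2_def algebra_simps)
  \<comment> \<open>These boundary terms are not partitions. Exchanging adjacent rows of the
    determinant replaces neighbouring parts p, q by q - 1, p + 1 and changes the sign; a shape fixed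
    by this exchange gives zero.\<close>
  have "U (m + 2) = - U (m + 1)" "T 0 = 0" "V 0 = - T 1" "T (m + 1) = 0"
    by (simp_all add: U_def T_def V_def schur3_def schur2_def algebra_simps)
  note straighten = this
  have "plethysm (complete_homogeneous 2) (complete_homogeneous 1 * complete_homogeneous m)
      = (\<Sum>k\<le>m. if even k then U k + U (k + 1) + U (k + 2) + T k + T (k + 1) + V k
            else U (k + 1) + T k + T (k + 1) + W k)"
    unfolding plethysm_eq_sum_products
  proof (rule sum.cong[OF refl])
    fix k
    define l where "l = int (2 * m) - int k"
    have l: "U k = schur2 (l + 2) (int k)" "U (k + 1) = schur2 (l + 1) (int k + 1)"
      "U (k + 2) = schur2 l (int k + 2)" "T k = schur3 (l + 1) (int k) 1"
      "T (k + 1) = schur3 l (int k + 1) 1" "V k = schur3 l (int k) 2" "W k = schur_1_1 l (int k)"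
      by (simp_all add: U_def T_def V_def W_def l_def algebra_simps)
    show "(if even k then hom_sym 2 else hom_sym 1 ^ 2 - hom_sym 2)
        * schur2 (int (2 * m) - int k) (int k)
      = (if even k then U k + U (k + 1) + U (k + 2) + T k + T (k + 1) + V k
         else U (k + 1) + T k + T (k + 1) + W k)"
      unfolding l l_def[symmetric] by (simp only: pieri_horizontal pieri_vertical split: if_split) simp
  qed
  also have "\<dots> = (\<Sum>a | 1 \<le> a \<and> a \<le> m \<and> odd a. W a) + (\<Sum>a | 2 \<le> a \<and> a \<le> m \<and> even a. V a)
      + T 1 + (\<Sum>a | 2 \<le> a \<and> a \<le> m. 2 * T a) + U 1 + (\<Sum>a | 2 \<le> a \<and> a \<le> m \<and> even a. 3 * U a)
      + (\<Sum>a | 2 \<le> a \<and> a \<le> m \<and> odd a. U a) + 2 * of_bool (even n) * U n + U 0"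
    unfolding sum_pieri_terms[OF \<open>1 \<le> m\<close>]
    using straighten by (simp add: n(1))
  also have "\<dots> = (\<Sum>a | 1 \<le> a \<and> a \<le> n - 1 \<and> odd a. schur [1, 1, a, 2 * n - 2 - a])
    + (\<Sum>a | 2 \<le> a \<and> a \<le> n - 1 \<and> even a. schur [2, a, 2 * n - 2 - a])
    + schur [1, 1, 2 * n - 2]
    + (\<Sum>a | 2 \<le> a \<and> a \<le> n - 1. 2 * schur [1, a, 2 * n - 1 - a])
    + schur [1, 2 * n - 1]
    + (\<Sum>a | 2 \<le> a \<and> a \<le> n - 1 \<and> even a. 3 * schur [a, 2 * n - a])
    + (\<Sum>a | 2 \<le> a \<and> a \<le> n - 1 \<and> odd a. schur [a, 2 * n - a])
    + 2 * of_bool (even n) * schur [n, n] + schur [2 * n]"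
  proof -
    have "schur [1, 1, 2 * n - 2] = T 1" "schur [1, 2 * n - 1] = U 1" "schur [n, n] = U n"
      using T[of 1] U[of 1] U[of n] n by (auto simp: mult_2)
    moreover have
      "(\<Sum>a | 1 \<le> a \<and> a \<le> m \<and> odd a. schur [1, 1, a, 2 * n - 2 - a]) = (\<Sum>a | 1 \<le> a \<and> a \<le> m \<and> odd a. W a)"
      "(\<Sum>a | 2 \<le> a \<and> a \<le> m \<and> even a. schur [2, a, 2 * n - 2 - a]) = (\<Sum>a | 2 \<le> a \<and> a \<le> m \<and> even a. V a)"
      "(\<Sum>a | 2 \<le> a \<and> a \<le> m. 2 * schur [1, a, 2 * n - 1 - a]) = (\<Sum>a | 2 \<le> a \<and> a \<le> m. 2 * T a)"
      "(\<Sum>a | 2 \<le> a \<and> a \<le> m \<and> even a. 3 * schur [a, 2 * n - a]) = (\<Sum>a | 2 \<le> a \<and> a \<le> m \<and> even a. 3 * U a)"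
      "(\<Sum>a | 2 \<le> a \<and> a \<le> m \<and> odd a. schur [a, 2 * n - a]) = (\<Sum>a | 2 \<le> a \<and> a \<le> m \<and> odd a. U a)"
      using W V T U n by (auto intro!: sum.cong)
    ultimately show ?thesis
      unfolding m_def[symmetric] U0 by (simp only:)
  qed
  finally show ?thesis by (simp add: m_def)
qed

end
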